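(* Define sequences $(a_m),(b_m),(c_m)$ by $a_1 = 4/5$, $a_{m+1} = \frac{4-a_m}{5-2a_m}$; $b_1 = 1/2$, $b_{m+1} = b_m/3$; $c_1 = 1/2$, $c_{m+1} = \frac{4-c_m}{5-2c_m}$ for $m=1,2,\ldots$. Let $\alpha\in\mathbb{R}$ and let $a/q$ be a reduced fraction with $|\alpha - a/q|\leqslant 1/q^2$. Then for $X\geqslant 2$, every integer $k\geqslant 2$ and every fixed $\varepsilon>0$, \[ \sum_{n\leqslant X}\mu_k(n)\operatorname{e}(n\alpha) \ll_\varepsilon X^{a_k+\varepsilon} + \frac{X(\log X)^{k^2}}{q^{b_k}} + X^{c_k}q^{1-c_k}(\log X)^{k^2}. \]
   Context: $\mu$ is the Möbius function and, for a positive integer $k$, $\mu_k = \mu*\mu*\cdots*\mu$ is the $k$-fold Dirichlet convolution of $\mu$ with itself, i.e. $\sum_{n\geqslant1}\mu_k(n)n^{-s} = \zeta(s)^{-k}$ for $\operatorname{Re}(s)>1$. $\operatorname{e}(x)=\exp(2\pi i x)$.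
   Formalization: The implied constant depends on k as well as on ε: a constant depending on ε alone is impossible, since for X = 2, α = 0, a/q = 0/1 the left side is k − 1 while the right side stays bounded as k grows. *)

theory Defs
  imports Complex_Main "HOL-Computational_Algebra.Computational_Algebra"
begin

definition moebius :: "nat \<Rightarrow> int" where
  "moebius n = (if squarefree n then (-1) ^ card (prime_factors n) else 0)"

definition dirichlet_conv :: "(nat \<Rightarrow> int) \<Rightarrow> (nat \<Rightarrow> int) \<Rightarrow> nat \<Rightarrow> int" where
  "dirichlet_conv f g n = (\<Sum>d | d dvd n. f d * g (n div d))"

text \<open>\<open>moebius_conv k\<close> is the \<open>k\<close>-fold Dirichlet convolution of \<open>moebius\<close> with itself.
  The case \<open>k = 0\<close> is the convolution identity. Only positive arguments \<open>n\<close> are meaningful.\<close>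

primrec moebius_conv :: "nat \<Rightarrow> nat \<Rightarrow> int" where
  "moebius_conv 0 = (\<lambda>n. if n = 1 then 1 else 0)"
| "moebius_conv (Suc k) = dirichlet_conv moebius (moebius_conv k)"

definition e2pi :: "real \<Rightarrow> complex" where
  "e2pi x = exp (2 * of_real pi * \<i> * of_real x)"

end

theory Submission
  imports "HOL-Analysis.Harmonic_Numbers" "HOL-Analysis.Convex" Defs
begin

text \<open>
  In the ring of arithmetic functions under Dirichlet convolution let \<open>y\<close> be the Moebius function,
  \<open>z = 1 / y\<close> the constant function 1, and \<open>g\<close> the truncation of \<open>y\<close> to arguments \<open>n \<le> V\<close>,
  where \<open>V = N\<close> to the power \<open>1 / (k + 2)\<close>. The polynomial \<open>y^(k+1) - (k+1) g^k y + k g^(k+1)\<close>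
  has a double zero at \<open>y = g\<close>, which yields a Vaughan-type identity
  \<open>y^k = (k+1) g^k - k g^(k+1) z + (y - g) (1 - g z) P\<close>.
  The first term has short support, the second one is a type I sum, and in the last one both
  \<open>y - g\<close> and \<open>1 - g z\<close> are supported on \<open>n > V\<close>, so that it is a type II sum. All coefficients are
  dominated by multiples of the divisor function \<open>z^(k+1)\<close>. Cauchy-Schwarz and the
  \<open>1 / (2 q)\<close>-spacing of the points \<open>n \<alpha>\<close> modulo 1 give a bound with the exponents \<open>1 / 2\<close> in place of
  \<open>b k\<close> and \<open>1 - c k\<close>, and a slightly larger power of the logarithm. As \<open>b k\<close> and \<open>1 - c k\<close>
  are at most \<open>1 / 4\<close>, the surplus logarithms are absorbed unless the trivial bound already suffices.
\<close>

section \<open>The ring of arithmetic functions\<close>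

text \<open>Every natural number divides 0, so the sum ranges over an infinite set and takes the
  default value 0.\<close>

lemma dirichlet_conv_0: "dirichlet_conv f g 0 = 0"
  by (simp add: dirichlet_conv_def infinite_UNIV_nat)

lemma dirichlet_conv_commute: "dirichlet_conv f g = dirichlet_conv g f"
proof
  fix n
  show "dirichlet_conv f g n = dirichlet_conv g f n"
  proof (cases "n = 0")
    case False
    show ?thesis
      unfolding dirichlet_conv_def
      by (rule sum.reindex_bij_witness[of _ "\<lambda>d. n div d" "\<lambda>d. n div d"])
        (use False in \<open>auto simp: dvd_div_eq_mult\<close>)
  qed (simp add: dirichlet_conv_0)
qed

text \<open>Both sides sum over the factorisations of \<open>n\<close> into three factors: a pair
  \<open>(d, c)\<close> with \<open>c dvd d\<close> and \<open>d dvd n\<close> corresponds to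
  \<open>(c, b)\<close> with \<open>d = c * b\<close>.\<close>

lemma dirichlet_conv_assoc:
  "dirichlet_conv (dirichlet_conv f g) h = dirichlet_conv f (dirichlet_conv g h)"
proof
  fix n
  show "dirichlet_conv (dirichlet_conv f g) h n = dirichlet_conv f (dirichlet_conv g h) n"
  proof (cases "n = 0")
    case False
    have fin: "finite {d. d dvd m}" if "m dvd n" for m
      using that False by (metis finite_divisors_nat dvd_0_left_iff gr0I)
    have "dirichlet_conv (dirichlet_conv f g) h n =
        (\<Sum>(d, c) \<in> (SIGMA d:{d. d dvd n}. {c. c dvd d}). f c * g (d div c) * h (n div d))"
      unfolding dirichlet_conv_def sum_distrib_right
      by (subst sum.Sigma) (use fin in auto)
    also have "\<dots> = (\<Sum>(c, b) \<in> (SIGMA c:{c. c dvd n}. {b. b dvd n div c}).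
        f c * (g b * h (n div c div b)))"
      by (rule sum.reindex_bij_witness[of _ "\<lambda>(c, b). (c * b, c)" "\<lambda>(d, c). (c, d div c)"])
        (use False in \<open>auto simp: dvd_div_eq_mult dvd_mult_div_cancel div_mult2_eq
           intro: dvd_trans div_dvd_div elim!: dvdE\<close>)
    also have "\<dots> = dirichlet_conv f (dirichlet_conv g h) n"
      unfolding dirichlet_conv_def sum_distrib_left
      by (subst sum.Sigma) (use fin in \<open>auto simp: div_dvd_iff_mult\<close>)
    finally show ?thesis .
  qed (simp add: dirichlet_conv_0)
qed

text \<open>A convolution always takes the value 0 at 0. Fixing \<open>f 0 = 0\<close> makes the
  unit law \<open>1 * f = f\<close> hold at 0 too, so that a genuine commutative ring
  arises.\<close>

typedef arith_fun = "{f :: nat \<Rightarrow> int. f 0 = 0}" morphisms coef Abs_arith_fun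
  by (rule exI[of _ "\<lambda>_. 0"]) simp

setup_lifting type_definition_arith_fun

instantiation arith_fun :: comm_ring_1
begin

lift_definition zero_arith_fun :: arith_fun is "\<lambda>_. 0" by simp
lift_definition one_arith_fun :: arith_fun is "\<lambda>n. if n = 1 then 1 else 0" by simp
lift_definition plus_arith_fun :: "arith_fun \<Rightarrow> arith_fun \<Rightarrow> arith_fun" is "\<lambda>f g n. f n + g n" by simp
lift_definition minus_arith_fun :: "arith_fun \<Rightarrow> arith_fun \<Rightarrow> arith_fun" is "\<lambda>f g n. f n - g n" by simp
lift_definition uminus_arith_fun :: "arith_fun \<Rightarrow> arith_fun" is "\<lambda>f n. - f n" by simp
lift_definition times_arith_fun :: "arith_fun \<Rightarrow> arith_fun \<Rightarrow> arith_fun" is dirichlet_conv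
  by (rule dirichlet_conv_0)

instance
proof
  fix a b c :: arith_fun
  show "a * b * c = a * (b * c)" by transfer (rule dirichlet_conv_assoc)
  show "a * b = b * a" by transfer (rule dirichlet_conv_commute)
  show "1 * a = a"
  proof transfer
    fix f :: "nat \<Rightarrow> int" assume "f 0 = 0"
    have "dirichlet_conv (\<lambda>n. if n = 1 then 1 else 0) f n = f n" for n
    proof (cases "n = 0")
      case False
      hence "dirichlet_conv (\<lambda>n. if n = 1 then 1 else 0) f n =
          (\<Sum>d\<in>{d. d dvd n}. if d = 1 then f n else 0)"
        unfolding dirichlet_conv_def by (intro sum.cong) auto
      thus ?thesis using False by simp
    qed (simp add: dirichlet_conv_0 \<open>f 0 = 0\<close>)
    thus "dirichlet_conv (\<lambda>n. if n = 1 then 1 else 0) f = f" ..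
  qed
  show "(a + b) * c = a * c + b * c"
    by transfer (simp add: fun_eq_iff dirichlet_conv_def sum.distrib distrib_right)
qed (transfer; simp add: fun_eq_iff)+

end

lemma coef_0_right [simp]: "coef f 0 = 0"
  using coef[of f] by simp

lemma coef_add: "coef (f + g) n = coef f n + coef g n" by transfer simp
lemma coef_diff: "coef (f - g) n = coef f n - coef g n" by transfer simp
lemma coef_one: "coef 1 n = (if n = 1 then 1 else 0)" by transfer simp
lemma coef_mult: "coef (f * g) n = (\<Sum>d | d dvd n. coef f d * coef g (n div d))"
  by transfer (simp add: dirichlet_conv_def)

lemma coef_of_nat_mult: "coef (of_nat j * f) n = int j * coef f n"
proof (induction j)
  case 0
  show ?case by simp (transfer, simp)
qed (simp add: distrib_right coef_add)

section \<open>The Moebius function as the inverse of the constant function 1\<close>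

lift_definition mu :: arith_fun is moebius by (simp add: moebius_def)
lift_definition zeta :: arith_fun is "\<lambda>n. if n = 0 then 0 else 1" by simp
lift_definition trunc :: "real \<Rightarrow> arith_fun \<Rightarrow> arith_fun" is
  "\<lambda>V f n. if real n \<le> V then f n else 0" by simp

lemmas coef_mu = mu.rep_eq and coef_zeta = zeta.rep_eq and coef_trunc = trunc.rep_eq

lemma moebius_conv_eq: "moebius_conv k = coef (mu ^ k)"
proof (induction k)
  case 0
  show ?case by (simp add: one_arith_fun.rep_eq)
next
  case (Suc k)
  thus ?case by (simp add: times_arith_fun.rep_eq coef_mu)
qed

lemma moebius_prime_mult:
  assumes "prime p" "\<not> p dvd d"
  shows "moebius (p * d) = - moebius d"
proof (cases "d = 0")
  case False
  have cop: "coprime p d" using assms by (simp add: prime_imp_coprime)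
  have "squarefree (p * d) \<longleftrightarrow> squarefree d"
    using assms(1) cop by (auto simp: squarefree_mult_coprime squarefree_prime dest: squarefree_multD)
  moreover have "prime_factors (p * d) = insert p (prime_factors d)"
    using assms False by (simp add: prime_factors_product prime_prime_factors prime_factorization_prime)
  moreover have "p \<notin> prime_factors d" using assms by auto
  ultimately show ?thesis by (simp add: moebius_def)
qed (use assms in auto)

text \<open>For a fixed prime \<open>p\<close> dividing \<open>n\<close>, the squarefree divisors
  pair off as \<open>d\<close> and \<open>p * d\<close> with \<open>d\<close> prime to
  \<open>p\<close>, and the two members of a pair have opposite signs. \<open>A\<close> and
  \<open>B\<close> hold the two kinds of divisor.\<close>

lemma sum_moebius_divisors:
  assumes "n > 1"
  shows "(\<Sum>d | d dvd n. moebius d) = 0"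
proof -
  obtain p where p: "prime p" "p dvd n"
    using assms by (metis prime_factor_nat less_numeral_extra(4))
  define A where "A = {d. d dvd n \<and> \<not> p dvd d}"
  define B where "B = {d. d dvd n \<and> p dvd d \<and> squarefree d}"
  have fin: "finite {d. d dvd n}" using assms by simp
  have "(\<Sum>d | d dvd n. moebius d) = (\<Sum>d\<in>{d. d dvd n \<and> squarefree d}. moebius d)"
    by (rule sum.mono_neutral_right) (use fin in \<open>auto simp: moebius_def\<close>)
  also have "{d. d dvd n \<and> squarefree d} = {d\<in>A. squarefree d} \<union> B"
    by (auto simp: A_def B_def)
  also have "sum moebius \<dots> = sum moebius {d\<in>A. squarefree d} + sum moebius B"
    by (rule sum.union_disjoint) (auto simp: A_def B_def intro: finite_subset[OF _ fin])
  also have "sum moebius B = (\<Sum>d\<in>{d\<in>A. squarefree d}. moebius (p * d))"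
  proof (rule sum.reindex_bij_witness[of _ "\<lambda>d. p * d" "\<lambda>d. d div p"])
    fix d assume d: "d \<in> B"
    then obtain c where c: "d = p * c" by (auto simp: B_def)
    have p0: "p > 0" using p prime_gt_0_nat by blast
    have sq: "squarefree c" using d c by (auto simp: B_def dest: squarefree_multD)
    have "\<not> p dvd c"
    proof
      assume "p dvd c"
      hence "p\<^sup>2 dvd d" using c by (simp add: power2_eq_square)
      hence "p dvd 1" using d unfolding B_def squarefree_def by blast
      thus False using p by auto
    qed
    moreover have "c dvd n" using d c by (auto simp: B_def elim: dvd_mult_right)
    ultimately show "d div p \<in> {d\<in>A. squarefree d}" using sq c p0 by (simp add: A_def)
    show "p * (d div p) = d" using c p0 by simp
    show "moebius (p * (d div p)) = moebius d" using c p0 by simp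
  next
    fix d assume d: "d \<in> {d\<in>A. squarefree d}"
    have cop: "coprime p d" using d p by (auto simp: A_def intro: prime_imp_coprime)
    show "p * d \<in> B" using d p cop
      by (auto simp: A_def B_def squarefree_mult_coprime squarefree_prime divides_mult)
    show "p * d div p = d" using p prime_gt_0_nat by simp
  qed
  also have "\<dots> = (\<Sum>d\<in>{d\<in>A. squarefree d}. - moebius d)"
    using p by (intro sum.cong) (auto simp: A_def moebius_prime_mult)
  finally show ?thesis by (simp add: sum_negf)
qed

lemma mu_zeta: "mu * zeta = 1"
proof -
  have "coef (mu * zeta) n = coef 1 n" for n
  proof (cases "n = 0")
    case False
    hence "coef (mu * zeta) n = (\<Sum>d | d dvd n. moebius d)"
      unfolding coef_mult coef_mu coef_zeta
      by (intro sum.cong) (auto elim!: dvdE)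
    moreover have "\<dots> = coef 1 n"
    proof (cases "n = 1")
      case True thus ?thesis by (simp add: coef_one moebius_def)
    qed (use False sum_moebius_divisors[of n] in \<open>simp add: coef_one\<close>)
    ultimately show ?thesis by simp
  qed simp
  thus ?thesis by (simp add: coef_inject[symmetric] fun_eq_iff)
qed

section \<open>The Vaughan-type identity for powers\<close>

text \<open>The sum over \<open>j\<close> is the quotient of
  \<open>y^(k+1) - (k+1) g^k y + k g^(k+1)\<close> by \<open>(y - g)^2\<close>. Multiplication by
  \<open>z\<close> turns one of the two factors \<open>y - g\<close> into \<open>1 - g * z\<close>.
  The induction rests on the recursion \<open>P (Suc k) = y * P k + (k+1) * g^k\<close>.\<close>

lemma power_inverse_identity:
  fixes y g z :: "'a :: comm_ring_1"
  assumes "y * z = 1"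
  shows "y ^ k = of_nat (k + 1) * g ^ k - of_nat k * (g ^ (k + 1) * z) +
    (y - g) * ((1 - g * z) * (\<Sum>j<k. of_nat (j + 1) * (g ^ j * y ^ (k - 1 - j))))"
proof (induction k)
  case (Suc k)
  define P where "P k = (\<Sum>j<k. of_nat (j + 1) * (g ^ j * y ^ (k - 1 - j)))" for k
  have "(\<Sum>j<k. of_nat (j + 1) * (g ^ j * y ^ (k - j))) = y * P k"
    unfolding P_def sum_distrib_left
  proof (intro sum.cong refl)
    fix j assume "j \<in> {..<k}"
    hence "k - j = Suc (k - 1 - j)" by auto
    thus "of_nat (j + 1) * (g ^ j * y ^ (k - j)) = y * (of_nat (j + 1) * (g ^ j * y ^ (k - 1 - j)))"
      by (simp only: power_Suc mult_ac)
  qed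
  hence P: "P (Suc k) = y * P k + of_nat (k + 1) * g ^ k"
    unfolding P_def by simp
  have IH: "y ^ k = of_nat (k + 1) * g ^ k - of_nat k * (g ^ (k + 1) * z) + (y - g) * ((1 - g * z) * P k)"
    using Suc.IH unfolding P_def .
  \<comment> \<open>The induction step as pure algebra, with \<open>c\<close>, \<open>u\<close>,
    \<open>p\<close> standing for \<open>k\<close>, \<open>g ^ k\<close>, \<open>P k\<close>; only
    the relation \<open>y * z = 1\<close> enters.\<close>
  have step: "y * ((1 + c) * u - c * (g * u * z) + (y - g) * ((1 - g * z) * p)) =
      (1 + (1 + c)) * (g * u) - (1 + c) * (g * (g * u) * z)
      + (y - g) * ((1 - g * z) * (y * p + (1 + c) * u))" for c u p :: 'a
  proof -
    have yz: "(y * w) * z = w" for w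
      by (metis assms mult.assoc mult.commute mult_1)
    have yz': "y * (z * w) = w" for w
      using yz[of w] by (simp add: mult_ac)
    show ?thesis
      by (simp add: algebra_simps yz' assms)
  qed
  have "y ^ Suc k = of_nat (Suc k + 1) * g ^ Suc k - of_nat (Suc k) * (g ^ (Suc k + 1) * z)
      + (y - g) * ((1 - g * z) * P (Suc k))"
    using step[of "of_nat k" "g ^ k" "P k"] unfolding P power_Suc IH by simp
  thus ?case unfolding P_def .
qed simp

section \<open>Majorants and divisor sums\<close>

text \<open>The absolute value stands on the left only, so a majorant is automatically nonnegative
  and the relation is reflexive exactly on functions with nonnegative coefficients.\<close>

definition majorized :: "arith_fun \<Rightarrow> arith_fun \<Rightarrow> bool" (infix "\<preceq>" 50) where
  "f \<preceq> h \<longleftrightarrow> (\<forall>n. \<bar>coef f n\<bar> \<le> coef h n)"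

lemma majorizedD: "f \<preceq> h \<Longrightarrow> \<bar>coef f n\<bar> \<le> coef h n"
  by (simp add: majorized_def)

lemma majorized_nonneg: "f \<preceq> h \<Longrightarrow> 0 \<le> coef h n"
  using majorizedD[of f h n] by linarith

lemma majorized_mult:
  assumes "f \<preceq> h" "f' \<preceq> h'"
  shows "f * f' \<preceq> h * h'"
  unfolding majorized_def coef_mult
proof
  fix n
  show "\<bar>\<Sum>d | d dvd n. coef f d * coef f' (n div d)\<bar> \<le> (\<Sum>d | d dvd n. coef h d * coef h' (n div d))"
    using assms
    by (intro order_trans[OF sum_abs] sum_mono)
       (auto simp: abs_mult intro!: mult_mono majorizedD intro: majorized_nonneg)
qed

lemma majorized_add: "f \<preceq> h \<Longrightarrow> f' \<preceq> h' \<Longrightarrow> f + f' \<preceq> h + h'"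
  unfolding majorized_def coef_add by (meson abs_triangle_ineq add_mono order_trans)

lemma majorized_diff: "f \<preceq> h \<Longrightarrow> f' \<preceq> h' \<Longrightarrow> f - f' \<preceq> h + h'"
  unfolding majorized_def coef_add coef_diff by (meson abs_triangle_ineq4 add_mono order_trans)

lemma majorized_zero: "0 \<preceq> 0"
  unfolding majorized_def by transfer simp

lemma majorized_sum: "(\<And>j. j \<in> A \<Longrightarrow> f j \<preceq> h j) \<Longrightarrow> sum f A \<preceq> sum h A"
  by (induction A rule: infinite_finite_induct) (auto intro: majorized_add majorized_zero)

lemma majorized_one: "1 \<preceq> 1"
  by (simp add: majorized_def coef_one)

lemma majorized_power: "f \<preceq> h \<Longrightarrow> f ^ j \<preceq> h ^ j"
  by (induction j) (auto intro: majorized_mult majorized_one)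

lemma majorized_of_nat_mult: "f \<preceq> h \<Longrightarrow> of_nat j * f \<preceq> of_nat j * h"
  unfolding majorized_def coef_of_nat_mult by (simp add: abs_mult mult_left_mono)

lemma majorized_trunc: "f \<preceq> h \<Longrightarrow> trunc V f \<preceq> h"
  using majorized_nonneg[of f h] by (auto simp: majorized_def coef_trunc)

lemma majorized_diff_trunc: "f \<preceq> h \<Longrightarrow> f - trunc V f \<preceq> h"
  using majorized_nonneg[of f h] by (auto simp: majorized_def coef_diff coef_trunc)

section \<open>Powers of \<open>zeta\<close>, the iterated divisor functions, and their
  means\<close>

lemma one_majorized_zeta: "1 \<preceq> zeta"
  by (simp add: majorized_def coef_one coef_zeta)

lemma mu_majorized_zeta: "mu \<preceq> zeta"
  by (simp add: majorized_def coef_mu coef_zeta Defs.moebius_def power_abs)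

lemma zeta_majorized: "zeta \<preceq> zeta"
  by (simp add: majorized_def coef_zeta)

lemma zeta_power_mono: "i \<le> j \<Longrightarrow> zeta ^ i \<preceq> zeta ^ j"
proof -
  assume "i \<le> j"
  have "zeta ^ i * 1 ^ (j - i) \<preceq> zeta ^ i * zeta ^ (j - i)"
    by (intro majorized_mult majorized_power zeta_majorized one_majorized_zeta)
  thus ?thesis using \<open>i \<le> j\<close> by (simp flip: power_add)
qed

lemma coef_zeta_power_nonneg: "0 \<le> coef (zeta ^ j) n"
  using majorizedD[OF zeta_power_mono[OF order_refl], of j n] by linarith

lemma coef_zeta_power_one: "coef (zeta ^ j) 1 = 1"
  by (induction j) (simp_all add: coef_one coef_mult coef_zeta)

lemma coef_zeta_power_Suc:
  assumes "n > 0" shows "coef (zeta ^ Suc j) n = (\<Sum>d | d dvd n. coef (zeta ^ j) d)"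
  unfolding power_Suc2 coef_mult coef_zeta using assms by (intro sum.cong) auto

text \<open>Induction on \<open>j\<close>, writing the next divisor function as a divisor sum. A
  divisor \<open>e\<close> of \<open>m * n\<close> splits into \<open>gcd e m\<close>, which divides
  \<open>m\<close>, and the cofactor, which divides \<open>n\<close>; this map into pairs of
  divisors is injective because the product of the pair recovers \<open>e\<close>.\<close>

lemma coef_zeta_power_submult:
  assumes "m > 0" "n > 0"
  shows "coef (zeta ^ j) (m * n) \<le> coef (zeta ^ j) m * coef (zeta ^ j) n"
  using assms
proof (induction j arbitrary: m n)
  case 0
  thus ?case by (simp add: coef_one)
next
  case (Suc j)
  let ?c = "coef (zeta ^ j)"
  let ?s = "\<lambda>e. (gcd e m, e div gcd e m)"
  have inj: "inj_on ?s {e. e dvd m * n}"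
  proof (intro inj_onI)
    fix e e' assume "?s e = ?s e'"
    hence h: "gcd e m = gcd e' m" "e div gcd e m = e' div gcd e' m"
      unfolding prod.inject by blast+
    have "e = gcd e m * (e div gcd e m)" by simp
    also have "\<dots> = gcd e' m * (e' div gcd e' m)" by (rule arg_cong2[OF h])
    also have "\<dots> = e'" by simp
    finally show "e = e'" .
  qed
  have sub: "?s ` {e. e dvd m * n} \<subseteq> {d. d dvd m} \<times> {d. d dvd n}"
  proof clarsimp
    fix e assume e: "e dvd m * n"
    \<comment> \<open>After cancelling the gcd, the cofactor \<open>u\<close> of \<open>e\<close>
      divides \<open>v * n\<close> and is coprime to \<open>v\<close>, so it divides
      \<open>n\<close>.\<close>
    obtain u v where "e = u * gcd e m" "m = v * gcd e m" "coprime u v"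
      using gcd_coprime_exists[of e m] Suc.prems by auto
    hence uv: "e = gcd e m * u" "m = gcd e m * v" "coprime u v"
      by (simp_all only: mult.commute)
    have g: "gcd e m > 0" using Suc.prems by simp
    have "gcd e m * u dvd gcd e m * (v * n)"
      using e by (subst (asm) uv(1), subst (asm) uv(2)) (simp only: mult.assoc)
    hence "u dvd v * n" using Suc.prems(1) by simp
    hence "u dvd n" using uv(3) by (simp add: coprime_dvd_mult_right_iff)
    moreover have "e div gcd e m = u" using g by (subst uv(1)) simp
    ultimately show "e div gcd e m dvd n" by simp
  qed
  have fin: "finite ({d. d dvd m} \<times> {d. d dvd n})" using Suc.prems by simp
  have "coef (zeta ^ Suc j) (m * n) = (\<Sum>e | e dvd m * n. ?c e)"
    using Suc.prems by (intro coef_zeta_power_Suc) simp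
  also have "\<dots> \<le> (\<Sum>e | e dvd m * n. ?c (gcd e m) * ?c (e div gcd e m))"
  proof (rule sum_mono)
    fix e assume "e \<in> {e. e dvd m * n}"
    hence "e > 0" using Suc.prems by (auto intro: Nat.gr0I)
    hence "gcd e m > 0" "e div gcd e m > 0" by (auto simp: div_greater_zero_iff gcd_le1_nat)
    from Suc.IH[OF this] show "?c e \<le> ?c (gcd e m) * ?c (e div gcd e m)" by simp
  qed
  also have "\<dots> = (\<Sum>x\<in>?s ` {e. e dvd m * n}. ?c (fst x) * ?c (snd x))"
    using inj by (simp add: sum.reindex)
  also have "\<dots> \<le> (\<Sum>x\<in>{d. d dvd m} \<times> {d. d dvd n}. ?c (fst x) * ?c (snd x))"
    by (rule sum_mono2[OF fin sub]) (simp add: coef_zeta_power_nonneg)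
  also have "\<dots> = (\<Sum>d | d dvd m. ?c d) * (\<Sum>d | d dvd n. ?c d)"
    by (simp add: sum_product sum.cartesian_product case_prod_beta)
  also have "\<dots> = coef (zeta ^ Suc j) m * coef (zeta ^ Suc j) n"
    using Suc.prems by (simp only: coef_zeta_power_Suc)
  finally show ?case .
qed

text \<open>For \<open>n = d * e\<close>, submultiplicativity moves the factor at \<open>n\<close>
  onto \<open>d\<close> and \<open>e\<close>; the induction hypothesis absorbs the part at
  \<open>d\<close>, and the part at \<open>e\<close> supplies a further convolution with
  \<open>zeta ^ j\<close>. The case \<open>i = j\<close> bounds squares of divisor functions by a
  single divisor function, which gives mean squares below.\<close>

lemma coef_zeta_power_mult_le:
  "coef (zeta ^ j) n * coef (zeta ^ i) n \<le> coef (zeta ^ (i * j)) n"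
proof (induction i arbitrary: n)
  case 0
  show ?case using coef_zeta_power_one[of j] by (auto simp: coef_one)
next
  case (Suc i)
  show ?case
  proof (cases "n = 0")
    case False
    have "coef (zeta ^ j) n * coef (zeta ^ Suc i) n = (\<Sum>d | d dvd n. coef (zeta ^ j) n * coef (zeta ^ i) d)"
      using False by (simp only: coef_zeta_power_Suc sum_distrib_left)
    also have "\<dots> \<le> (\<Sum>d | d dvd n. coef (zeta ^ (i * j)) d * coef (zeta ^ j) (n div d))"
    proof (rule sum_mono)
      fix d assume "d \<in> {d. d dvd n}"
      then obtain e where e: "n = d * e" by auto
      hence de: "d > 0" "e > 0" using False by auto
      have "coef (zeta ^ j) n * coef (zeta ^ i) d \<le> (coef (zeta ^ j) d * coef (zeta ^ j) e) * coef (zeta ^ i) d"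
        unfolding e by (intro mult_right_mono coef_zeta_power_submult de coef_zeta_power_nonneg)
      also have "\<dots> = (coef (zeta ^ j) d * coef (zeta ^ i) d) * coef (zeta ^ j) e" by simp
      also have "\<dots> \<le> coef (zeta ^ (i * j)) d * coef (zeta ^ j) e"
        by (intro mult_right_mono Suc.IH coef_zeta_power_nonneg)
      finally show "coef (zeta ^ j) n * coef (zeta ^ i) d \<le> coef (zeta ^ (i * j)) d * coef (zeta ^ j) (n div d)"
        using e de by simp
    qed
    also have "\<dots> = coef (zeta ^ (Suc i * j)) n"
      by (simp only: coef_mult[symmetric] power_add[symmetric] mult_Suc add.commute)
    finally show ?thesis .
  qed simp
qed

text \<open>Grouping by the first factor turns a sum over a Dirichlet product into a double sum
  under the hyperbola. The weight is left general: it is \<open>1 / n\<close> for means and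
  \<open>e2pi\<close> for exponential sums.\<close>

lemma sum_coef_mult:
  fixes \<phi> :: "nat \<Rightarrow> 'a :: comm_ring_1"
  shows "(\<Sum>n = 1..N. of_int (coef (f * g) n) * \<phi> n) =
    (\<Sum>m = 1..N. of_int (coef f m) * (\<Sum>n = 1..N div m. of_int (coef g n) * \<phi> (m * n)))"
proof -
  have aux: "b \<le> N" if "0 < k" "b * k \<le> N" for b k :: nat
    using that by (cases k) auto
  have "(\<Sum>n = 1..N. of_int (coef (f * g) n) * \<phi> n) =
      (\<Sum>(n, m) \<in> (SIGMA n:{1..N}. {d. d dvd n}). of_int (coef f m) * (of_int (coef g (n div m)) * \<phi> n))"
    unfolding coef_mult of_int_sum sum_distrib_right
    by (subst sum.Sigma) (auto simp: mult.assoc intro!: sum.cong)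
  also have "\<dots> = (\<Sum>(m, n) \<in> (SIGMA m:{1..N}. {1..N div m}).
      of_int (coef f m) * (of_int (coef g n) * \<phi> (m * n)))"
    by (rule sum.reindex_bij_witness[of _ "\<lambda>(m, n). (m * n, m)" "\<lambda>(n, m). (m, n div m)"])
      (auto simp: less_eq_div_iff_mult_less_eq Suc_le_eq mult.commute elim!: dvdE
        intro: Nat.gr0I aux)
  also have "\<dots> = (\<Sum>m = 1..N. of_int (coef f m) * (\<Sum>n = 1..N div m. of_int (coef g n) * \<phi> (m * n)))"
    unfolding sum_distrib_left by (subst sum.Sigma) auto
  finally show ?thesis .
qed

text \<open>The weight \<open>1 / n\<close> is completely multiplicative, so each factor
  \<open>zeta\<close> contributes at most one harmonic sum once the inner range
  \<open>N div m\<close> is enlarged to \<open>N\<close>.\<close>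

lemma sum_zeta_power_div_le: "(\<Sum>n = 1..N. of_int (coef (zeta ^ j) n) / real n) \<le> harm N ^ j"
proof (induction j arbitrary: N)
  case 0
  have "(\<Sum>n = 1..N. of_int (coef (zeta ^ 0) n) / real n) = (\<Sum>n\<in>{1..N}. if n = 1 then 1 else 0)"
    by (intro sum.cong) (auto simp: coef_one)
  also have "\<dots> \<le> (1 :: real)" by simp
  finally show ?case by simp
next
  case (Suc j)
  have "(\<Sum>n = 1..N. of_int (coef (zeta ^ Suc j) n) / real n)
      = (\<Sum>m = 1..N. of_int (coef zeta m) * (\<Sum>n = 1..N div m. of_int (coef (zeta ^ j) n) * (1 / real (m * n))))"
    using sum_coef_mult[of zeta "zeta ^ j" "\<lambda>n. 1 / real n" N] by simp
  also have "\<dots> = (\<Sum>m = 1..N. (1 / real m) * (\<Sum>n = 1..N div m. of_int (coef (zeta ^ j) n) / real n))"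
    unfolding sum_distrib_left by (intro sum.cong) (auto simp: coef_zeta)
  also have "\<dots> \<le> (\<Sum>m = 1..N. (1 / real m) * harm N ^ j)"
    by (intro sum_mono mult_left_mono order_trans[OF Suc] power_mono harm_mono harm_nonneg) auto
  also have "\<dots> = harm N ^ Suc j"
    by (simp add: harm_def sum_distrib_right inverse_eq_divide)
  finally show ?case .
qed

lemma sum_le_of_sum_div:
  fixes f :: "nat \<Rightarrow> real"
  assumes "\<And>n. f n \<ge> 0"
  shows "(\<Sum>n = 1..N. f n) \<le> real N * (\<Sum>n = 1..N. f n / real n)"
  unfolding sum_distrib_left
proof (rule sum_mono)
  fix n assume "n \<in> {1..N}"
  hence "f n * real n \<le> f n * real N" "real n > 0" by (auto intro: mult_left_mono assms)
  thus "f n \<le> real N * (f n / real n)" by (simp add: field_simps)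
qed

lemma sum_zeta_power_le: "(\<Sum>n = 1..N. of_int (coef (zeta ^ j) n)) \<le> real N * harm N ^ j"
  by (rule order_trans[OF sum_le_of_sum_div mult_left_mono[OF sum_zeta_power_div_le]])
    (simp_all add: coef_zeta_power_nonneg)

lemma sum_zeta_power_sq_div_le:
  "(\<Sum>n = 1..N. (of_int (coef (zeta ^ j) n))\<^sup>2 / real n) \<le> harm N ^ (j * j)"
proof -
  have "(\<Sum>n = 1..N. (of_int (coef (zeta ^ j) n))\<^sup>2 / real n)
      \<le> (\<Sum>n = 1..N. of_int (coef (zeta ^ (j * j)) n) / real n)"
    unfolding power2_eq_square
    by (intro sum_mono divide_right_mono)
      (auto simp flip: of_int_mult intro: coef_zeta_power_mult_le)
  thus ?thesis using sum_zeta_power_div_le order_trans by blast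
qed

section \<open>Supports of convolution products\<close>

lemma coef_mult_eq_0:
  assumes "\<And>n. real n > V \<Longrightarrow> coef f n = 0" "\<And>n. real n > W \<Longrightarrow> coef g n = 0" "V \<ge> 0"
    and "real n > V * W"
  shows "coef (f * g) n = 0"
  unfolding coef_mult
proof (rule sum.neutral, clarify)
  fix d assume "d dvd n"
  then obtain e where e: "n = d * e" by auto
  show "coef f d * coef g (n div d) = 0"
  proof (cases "d = 0")
    case False
    have "real d > V \<or> real e > W"
    proof (rule ccontr)
      assume "\<not> ?thesis"
      hence "real d * real e \<le> V * W" using assms(3) by (intro mult_mono) auto
      thus False using assms(4) e by simp
    qed
    thus ?thesis using assms(1,2) e False by auto
  qed simp
qed

lemma coef_trunc_power_eq_0:
  assumes "V \<ge> 0" "real n > V ^ k"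
  shows "coef (trunc V f ^ k) n = 0"
  using assms(2)
proof (induction k arbitrary: n)
  case 0
  thus ?case by (simp add: coef_one)
next
  case (Suc k)
  show ?case unfolding power_Suc
    by (rule coef_mult_eq_0[of V _ "V ^ k"]) (use Suc assms(1) in \<open>auto simp: coef_trunc\<close>)
qed

lemma coef_mult_eq_0_le:
  assumes "\<And>n. real n \<le> V \<Longrightarrow> coef f n = 0" "real n \<le> V"
  shows "coef (f * g) n = 0"
proof (cases "n = 0")
  case False
  show ?thesis
    unfolding coef_mult
  proof (rule sum.neutral, clarify)
    fix d assume "d dvd n"
    hence "real d \<le> V" using dvd_imp_le[of d n] False assms(2) by auto
    thus "coef f d * coef g (n div d) = 0" using assms(1) by simp
  qed
qed simp

text \<open>Divisors of \<open>n\<close> do not exceed \<open>V\<close>, so the truncation is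
  invisible and \<open>mu * zeta = 1\<close> applies.\<close>

lemma coef_one_minus_trunc_mu_zeta:
  assumes "real n \<le> V"
  shows "coef (1 - trunc V mu * zeta) n = 0"
proof (cases "n = 0")
  case False
  have "coef (trunc V mu * zeta) n = coef (mu * zeta) n"
    unfolding coef_mult
  proof (intro sum.cong refl)
    fix d assume "d \<in> {d. d dvd n}"
    hence "real d \<le> V" using dvd_imp_le[of d n] False assms by auto
    thus "coef (trunc V mu) d * coef zeta (n div d) = coef mu d * coef zeta (n div d)"
      by (simp add: coef_trunc)
  qed
  thus ?thesis by (simp add: coef_diff mu_zeta)
qed simp

section \<open>Exponential sums\<close>

lemma e2pi_add: "e2pi (x + y) = e2pi x * e2pi y"
  by (simp add: e2pi_def exp_add distrib_left)

lemma norm_e2pi [simp]: "norm (e2pi x) = 1"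
  by (simp add: e2pi_def)

lemma cnj_e2pi: "cnj (e2pi x) = e2pi (- x)"
  by (simp add: e2pi_def exp_cnj)

lemma e2pi_of_nat_mult: "e2pi (of_nat n * x) = e2pi x ^ n"
  unfolding e2pi_def by (simp add: exp_of_nat_mult[symmetric] mult_ac)

text \<open>The distance from \<open>x\<close> to the nearest integer.\<close>

definition int_dist :: "real \<Rightarrow> real" where
  "int_dist x = min (frac x) (1 - frac x)"

lemma int_dist_minus: "int_dist (- x) = int_dist x"
  by (cases "x \<in> \<int>") (auto simp: int_dist_def frac_neg min.commute frac_eq_0_iff[THEN iffD2])

text \<open>A weak form of Jordan's inequality. Up to 1/3 the mean value theorem gives a slope of at
  least \<open>pi * cos (pi / 3)\<close>, which exceeds 1; beyond 1/3 monotonicity gives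
  \<open>sin (pi * t)\<close> at least \<open>sin (pi / 6)\<close>, that is 1/2.\<close>

lemma le_sin_pi:
  assumes "0 \<le> t" "t \<le> 1 / 2"
  shows "t \<le> sin (pi * t)"
proof (cases "t \<le> 1 / 3")
  case True
  show ?thesis
  proof (cases "t = 0")
    case False
    have "\<exists>z. 0 < z \<and> z < pi * t \<and> sin (pi * t) - sin 0 = (pi * t - 0) * cos z"
      using False assms by (intro MVT2) (auto intro!: derivative_eq_intros)
    then obtain z where z: "0 < z" "z < pi * t" "sin (pi * t) = pi * t * cos z" by auto
    have "pi * t \<le> pi / 3" using True by simp
    hence "z \<le> pi / 3" using z(2) by linarith
    hence "cos (pi / 3) \<le> cos z" using z(1) by (intro cos_monotone_0_pi_le) auto
    hence "pi * t * (1 / 2) \<le> sin (pi * t)"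
      unfolding z(3) cos_60 using assms by (intro mult_left_mono) auto
    moreover have "2 * t \<le> pi * t" using pi_gt3 assms by (intro mult_right_mono) auto
    ultimately show ?thesis by simp
  qed simp
next
  case False
  have "sin (pi / 6) \<le> sin (pi * t)"
    using assms False by (intro sin_monotone_2pi_le) auto
  thus ?thesis using assms by (simp add: sin_30)
qed

lemma int_dist_le_sin: "int_dist x \<le> \<bar>sin (pi * x)\<bar>"
proof -
  define t where "t = frac x"
  have t: "0 \<le> t" "t < 1" by (auto simp: t_def frac_lt_1)
  have "pi * x = pi * t + pi * of_int \<lfloor>x\<rfloor>" by (simp add: t_def frac_def algebra_simps)
  hence "\<bar>sin (pi * x)\<bar> = \<bar>sin (pi * t)\<bar>"
    by (simp add: sin_add abs_mult)
  moreover have "min t (1 - t) \<le> sin (pi * t)"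
  proof (cases "t \<le> 1 / 2")
    case True
    thus ?thesis using le_sin_pi[of t] t by simp
  next
    case False
    have "sin (pi * (1 - t)) = sin (pi * t)" by (simp add: algebra_simps sin_diff)
    thus ?thesis using le_sin_pi[of "1 - t"] t False by simp
  qed
  ultimately show ?thesis unfolding int_dist_def t_def by linarith
qed

lemma int_dist_le_norm_e2pi: "2 * int_dist x \<le> norm (e2pi x - 1)"
proof -
  have "e2pi x = exp (\<i> * of_real (2 * pi * x))" by (simp add: e2pi_def mult_ac)
  hence "norm (e2pi x - 1) = 2 * \<bar>sin (pi * x)\<bar>"
    by (simp only: dist_exp_i_1) simp
  thus ?thesis using int_dist_le_sin[of x] by simp
qed

lemma geometric_sum_interval:
  fixes z :: "'a :: comm_ring_1"
  assumes "a \<le> b" shows "(z - 1) * (\<Sum>m = a..<b. z ^ m) = z ^ b - z ^ a"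
  using assms by (induction rule: dec_induct) (auto simp: algebra_simps)

lemma norm_sum_e2pi_le: "norm (\<Sum>m = a..<b. e2pi (of_nat m * x)) \<le> real (b - a)"
  using sum_norm_le[of "{a..<b}" "\<lambda>m. e2pi (of_nat m * x)" "\<lambda>_. 1"] by simp

text \<open>The usual bound for a geometric sum, kept as a product so that it also covers integers
  \<open>x\<close>, where the distance is 0.\<close>

lemma norm_sum_e2pi_int_dist_le: "norm (\<Sum>m = a..<b. e2pi (of_nat m * x)) * int_dist x \<le> 1"
proof (cases "a \<le> b")
  case True
  let ?S = "\<Sum>m = a..<b. e2pi (of_nat m * x)"
  have "(e2pi x - 1) * ?S = e2pi x ^ b - e2pi x ^ a"
    using geometric_sum_interval[OF True, of "e2pi x"] by (simp add: e2pi_of_nat_mult)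
  hence "norm (e2pi x - 1) * norm ?S \<le> norm (e2pi x ^ b) + norm (e2pi x ^ a)"
    by (metis norm_mult norm_triangle_ineq4)
  hence "norm (e2pi x - 1) * norm ?S \<le> 2" by (simp add: norm_power)
  moreover have "2 * int_dist x * norm ?S \<le> norm (e2pi x - 1) * norm ?S"
    by (intro mult_right_mono int_dist_le_norm_e2pi) simp
  ultimately have "2 * int_dist x * norm ?S \<le> 2" by linarith
  thus ?thesis by (simp add: mult.commute)
qed simp

section \<open>Spacing of the multiples of \<open>\<alpha>\<close> modulo 1 and sums over
  them\<close>

definition rat_approx :: "real \<Rightarrow> int \<Rightarrow> nat \<Rightarrow> bool" where
  "rat_approx \<alpha> h q \<longleftrightarrow> q \<ge> 1 \<and> coprime h (int q) \<and> \<bar>\<alpha> - of_int h / of_nat q\<bar> \<le> 1 / (of_nat q)\<^sup>2"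

text \<open>Since \<open>q\<close> does not divide \<open>d\<close>, the number
  \<open>d * h / q\<close> is at least \<open>1 / q\<close> away from every integer. Replacing
  \<open>h / q\<close> by \<open>\<alpha>\<close> moves it by at most
  \<open>\<bar>d\<bar> / q^2\<close>, hence by at most \<open>1 / (2 * q)\<close>.\<close>

lemma rat_approx_spacing:
  assumes "rat_approx \<alpha> h q" "d \<noteq> 0" "\<bar>d\<bar> \<le> int (q div 2)"
  shows "1 / (2 * real q) \<le> \<bar>of_int d * \<alpha> - of_int z\<bar>"
proof -
  have q: "real q > 0" "q \<ge> 1" and cop: "coprime h (int q)"
    and \<alpha>: "\<bar>\<alpha> - of_int h / of_nat q\<bar> \<le> 1 / (of_nat q)\<^sup>2"
    using assms by (auto simp: rat_approx_def)
  have "\<not> int q dvd d * h"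
  proof
    assume "int q dvd d * h"
    hence "int q dvd d" using cop by (simp add: coprime_dvd_mult_left_iff coprime_commute)
    hence "int q \<le> \<bar>d\<bar>" using assms(2) by (metis abs_dvd_iff dvd_abs_iff dvd_imp_le_int abs_of_nat)
    thus False using assms(3) q by linarith
  qed
  hence "d * h - z * int q \<noteq> 0" by (metis dvd_triv_right eq_iff_diff_eq_0)
  hence "1 \<le> \<bar>d * h - z * int q\<bar>" by linarith
  hence "1 \<le> \<bar>of_int (d * h - z * int q) :: real\<bar>" by linarith
  hence "1 / real q \<le> \<bar>of_int (d * h - z * int q)\<bar> / real q"
    using q by (intro divide_right_mono) auto
  also have "\<dots> = \<bar>of_int d * (of_int h / real q) - of_int z\<bar>"
  proof -
    have "\<bar>of_int (d * h - z * int q)\<bar> / real q = \<bar>of_int (d * h - z * int q) / real q\<bar>"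
      using q by simp
    also have "of_int (d * h - z * int q) / real q = of_int d * (of_int h / real q) - of_int z"
      using q by (simp add: field_simps)
    finally show ?thesis .
  qed
  finally have 1: "1 / real q \<le> \<bar>of_int d * (of_int h / real q) - of_int z\<bar>" .
  have d: "\<bar>of_int d :: real\<bar> \<le> real q / 2" using assms(3) by linarith
  have "\<bar>of_int d * \<alpha> - of_int d * (of_int h / real q)\<bar> = \<bar>of_int d\<bar> * \<bar>\<alpha> - of_int h / real q\<bar>"
    by (simp only: abs_mult[symmetric] right_diff_distrib)
  also have "\<dots> \<le> (real q / 2) * (1 / (real q)\<^sup>2)"
    using d \<alpha> by (intro mult_mono) auto
  also have "\<dots> = 1 / (2 * real q)" using q by (simp add: power2_eq_square)
  finally have "\<bar>of_int d * \<alpha> - of_int d * (of_int h / real q)\<bar> \<le> 1 / (2 * real q)" .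
  moreover have "1 / real q = 1 / (2 * real q) + 1 / (2 * real q)" using q by (simp add: field_simps)
  ultimately show ?thesis using 1 by linarith
qed

lemma sum_reciprocal_le_harm: "(\<Sum>s<n. 1 / real s) \<le> harm n"
proof -
  have "(\<Sum>s<n. 1 / real s) = (\<Sum>s\<in>{1..<n}. 1 / real s)"
    by (intro sum.mono_neutral_right) (auto simp: not_less_eq_eq)
  also have "\<dots> \<le> (\<Sum>s\<in>{1..n}. 1 / real s)" by (intro sum_mono2) auto
  finally show ?thesis by (simp add: harm_def inverse_eq_divide)
qed

text \<open>The points \<open>n \<alpha> + \<beta>\<close> fall into distinct intervals of length \<open>1 / (2 q)\<close> modulo 1.\<close>

lemma sum_block_le:
  fixes F :: "nat \<Rightarrow> real"
  assumes "rat_approx \<alpha> h q" "finite B"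
    and diam: "\<And>m n. m \<in> B \<Longrightarrow> n \<in> B \<Longrightarrow> \<bar>int m - int n\<bar> \<le> int (q div 2)"
    and A: "0 \<le> A" "\<And>n. n \<in> B \<Longrightarrow> F n \<le> A"
    and F: "\<And>n. n \<in> B \<Longrightarrow> F n * int_dist (real n * \<alpha> + \<beta>) \<le> 1"
  shows "sum F B \<le> 2 * A + 4 * real q * harm (2 * q)"
proof -
  have q: "q \<ge> 1" using assms by (simp add: rat_approx_def)
  define f where "f n = frac (real n * \<alpha> + \<beta>)" for n :: nat
  define s where "s n = nat \<lfloor>2 * real q * f n\<rfloor>" for n
  \<comment> \<open>A bound for \<open>F n\<close> when the fractional part lies in the
    \<open>r\<close>-th interval of length \<open>1 / (2 * q)\<close>. In the two extreme intervals
    the distance to an integer may be tiny and \<open>A\<close> is used; elsewhere it is at least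
    \<open>r / (2 * q)\<close> or \<open>(2 * q - r - 1) / (2 * q)\<close>. The reciprocal of 0 is 0
    by convention.\<close>
  define bnd where "bnd r = (if r = 0 then A else 0) + (if r = 2 * q - 1 then A else 0)
     + 2 * real q * (1 / real r) + 2 * real q * (1 / real (2 * q - Suc r))" for r
  have f: "0 \<le> f n" "f n < 1" for n by (auto simp: f_def frac_lt_1)
  have s: "real (s n) \<le> 2 * real q * f n" "2 * real q * f n < real (s n) + 1" for n
  proof -
    have "0 \<le> \<lfloor>2 * real q * f n\<rfloor>" using f by simp
    hence "real (s n) = of_int \<lfloor>2 * real q * f n\<rfloor>" by (simp add: s_def)
    thus "real (s n) \<le> 2 * real q * f n" "2 * real q * f n < real (s n) + 1" by linarith+
  qed
  have s_less: "s n < 2 * q" for n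
  proof -
    have "2 * real q * f n < 2 * real q * 1" using f q by (intro mult_strict_left_mono) auto
    thus ?thesis using s(1)[of n] by linarith
  qed
  \<comment> \<open>Two points in one interval would differ by less than \<open>1 / (2 * q)\<close>
    modulo 1; the shift \<open>\<beta>\<close> cancels in the difference, so this contradicts the
    spacing.\<close>
  have inj: "inj_on s B"
  proof (rule inj_onI, rule ccontr)
    fix m n assume mn: "m \<in> B" "n \<in> B" "s m = s n" "m \<noteq> n"
    have "\<bar>2 * real q * f m - 2 * real q * f n\<bar> < 1" using s[of m] s[of n] mn(3) by linarith
    hence "2 * real q * \<bar>f m - f n\<bar> < 1" using q by (simp add: abs_mult flip: right_diff_distrib)
    moreover have "f m - f n = of_int (int m - int n) * \<alpha>
        - of_int (\<lfloor>real m * \<alpha> + \<beta>\<rfloor> - \<lfloor>real n * \<alpha> + \<beta>\<rfloor>)"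
      by (simp add: f_def frac_def algebra_simps)
    moreover have "1 / (2 * real q) \<le> \<bar>of_int (int m - int n) * \<alpha>
        - of_int (\<lfloor>real m * \<alpha> + \<beta>\<rfloor> - \<lfloor>real n * \<alpha> + \<beta>\<rfloor>)\<bar>"
      using mn by (intro rat_approx_spacing[OF assms(1)] diam) auto
    ultimately have "2 * real q * (1 / (2 * real q)) < 1"
      using q by (smt (verit) mult_left_mono of_nat_0_le_iff)
    thus False using q by simp
  qed
  have bnd: "F n \<le> bnd (s n)" if "n \<in> B" for n
  proof (cases "s n = 0 \<or> s n = 2 * q - 1")
    case True
    have "F n \<le> A" using that A by simp
    also have "\<dots> \<le> bnd (s n)" using True A by (auto simp: bnd_def)
    finally show ?thesis .
  next
    case False
    hence sn: "0 < s n" "0 < 2 * q - Suc (s n)" using s_less[of n] by auto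
    have r: "real (2 * q - Suc (s n)) = 2 * real q - (real (s n) + 1)"
      using s_less[of n] by (simp add: of_nat_diff)
    define d where "d = int_dist (real n * \<alpha> + \<beta>)"
    have d: "d = f n \<or> d = 1 - f n" by (auto simp: d_def int_dist_def f_def min_def)
    have Fd: "F n * d \<le> 1" using F that by (simp add: d_def)
    have "F n \<le> 2 * real q * (1 / real (s n)) \<or> F n \<le> 2 * real q * (1 / real (2 * q - Suc (s n)))"
    proof (rule ccontr)
      assume "\<not> ?thesis"
      hence *: "2 * real q < F n * real (s n)" "2 * real q < F n * real (2 * q - Suc (s n))"
        using sn by (simp_all add: field_simps)
      have "0 < F n" using *(1) sn q by (smt (verit) mult_nonpos_nonneg of_nat_0_le_iff)
      from d show False
      proof
        assume "d = f n"
        hence "F n * real (s n) \<le> F n * (2 * real q * d)"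
          using s(1)[of n] \<open>0 < F n\<close> by (intro mult_left_mono) auto
        also have "\<dots> = 2 * real q * (F n * d)" by simp
        also have "\<dots> \<le> 2 * real q * 1" using Fd by (intro mult_left_mono) auto
        finally show False using *(1) by simp
      next
        assume "d = 1 - f n"
        hence "2 * real q * (d + f n) = 2 * real q" by simp
        hence "2 * real q = 2 * real q * d + 2 * real q * f n" by (simp only: distrib_left)
        hence "F n * real (2 * q - Suc (s n)) \<le> F n * (2 * real q * d)"
          unfolding r using s(2)[of n] \<open>0 < F n\<close> by (intro mult_left_mono) auto
        also have "\<dots> = 2 * real q * (F n * d)" by simp
        also have "\<dots> \<le> 2 * real q * 1" using Fd by (intro mult_left_mono) auto
        finally show False using *(2) by linarith
      qed
    qed
    moreover have "0 \<le> 2 * real q * (1 / real (s n))" "0 \<le> 2 * real q * (1 / real (2 * q - Suc (s n)))"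
      by auto
    moreover have "bnd (s n) = 2 * real q * (1 / real (s n)) + 2 * real q * (1 / real (2 * q - Suc (s n)))"
      using False by (simp add: bnd_def)
    ultimately show ?thesis by (smt (verit))
  qed
  have bnd_nonneg: "0 \<le> bnd r" for r unfolding bnd_def using A(1) by (intro add_nonneg_nonneg) auto
  have "sum F B \<le> (\<Sum>n\<in>B. bnd (s n))" by (intro sum_mono bnd)
  also have "\<dots> = sum bnd (s ` B)" using inj by (simp add: sum.reindex)
  also have "\<dots> \<le> sum bnd {..<2 * q}" using s_less bnd_nonneg by (intro sum_mono2) auto
  also have "\<dots> = 2 * A + 2 * real q * (\<Sum>r<2 * q. 1 / real r) + 2 * real q * (\<Sum>r<2 * q. 1 / real (2 * q - Suc r))"
    unfolding bnd_def using q by (simp add: sum.distrib sum_distrib_left)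
  also have "(\<Sum>r<2 * q. 1 / real (2 * q - Suc r)) = (\<Sum>r<2 * q. 1 / real r)"
    by (rule sum.nat_diff_reindex)
  also have "2 * A + 2 * real q * (\<Sum>r<2 * q. 1 / real r) + 2 * real q * (\<Sum>r<2 * q. 1 / real r)
      = 2 * A + 4 * real q * (\<Sum>r<2 * q. 1 / real r)" by simp
  also have "\<dots> \<le> 2 * A + 4 * real q * harm (2 * q)"
    using sum_reciprocal_le_harm[of "2 * q"] by (intro add_left_mono mult_left_mono) auto
  finally show ?thesis .
qed

text \<open>Blocks of \<open>q div 2 + 1\<close> consecutive integers satisfy the diameter condition
  of \<open>sum_block_le\<close>, and at most \<open>2 * N / q + 1\<close> of them cover the
  interval.\<close>

lemma sum_interval_le:
  fixes F :: "nat \<Rightarrow> real"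
  assumes "rat_approx \<alpha> h q" and A: "0 \<le> A" "\<And>n. n \<in> {c..<c + N} \<Longrightarrow> F n \<le> A"
    and F: "\<And>n. n \<in> {c..<c + N} \<Longrightarrow> F n * int_dist (real n * \<alpha> + \<beta>) \<le> 1"
  shows "sum F {c..<c + N} \<le> (2 * real N / real q + 1) * (2 * A + 4 * real q * harm (2 * q))"
proof -
  define Q where "Q = q div 2 + 1"
  have q: "q \<ge> 1" using assms by (simp add: rat_approx_def)
  have Q: "real q / 2 \<le> real Q" "0 < Q" by (auto simp: Q_def)
  define E where "E = 2 * A + 4 * real q * harm (2 * q)"
  have E: "0 \<le> E" using A(1) by (auto simp: E_def harm_nonneg)
  have "sum F {c..<c + N} \<le> real t * E" if "N \<le> t * Q" for t
    using that A(2) F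
  proof (induction t arbitrary: c N)
    case (Suc t)
    define M where "M = min N Q"
    have "sum F {c..<c + N} = sum F {c..<c + M} + sum F {c + M..<c + N}"
      by (rule sum.atLeastLessThan_concat[symmetric]) (auto simp: M_def)
    moreover have "sum F {c..<c + M} \<le> E"
      unfolding E_def using Suc.prems
      by (intro sum_block_le[OF assms(1) _ _ A(1), of _ F \<beta>]) (auto simp: M_def Q_def)
    moreover have "sum F {c + M..<c + M + (N - M)} \<le> real t * E"
      using Suc.prems by (intro Suc.IH) (auto simp: M_def)
    ultimately show ?case by (simp add: M_def algebra_simps)
  qed simp
  moreover have "N \<le> (N div Q + 1) * Q"
    using Q(2) by (metis Suc_eq_plus1 dividend_less_times_div less_imp_le mult.commute mult_Suc_right add.commute)
  ultimately have "sum F {c..<c + N} \<le> real (N div Q + 1) * E" by blast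
  also have "\<dots> \<le> (2 * real N / real q + 1) * E"
  proof (intro mult_right_mono E)
    have "real (N div Q) \<le> real N / real Q" by (rule of_nat_div_le_of_nat)
    also have "\<dots> \<le> real N / (real q / 2)" using Q q by (intro divide_left_mono) auto
    finally show "real (N div Q + 1) \<le> 2 * real N / real q + 1" by (simp add: mult.commute)
  qed
  finally show ?thesis unfolding E_def .
qed

text \<open>The range is cut into blocks of length \<open>Q\<close>. On the \<open>t\<close>-th
  block with \<open>t \<ge> 1\<close> the trivial bound is \<open>N / (t * Q)\<close>, so that these
  bounds add up to a harmonic sum. The block next to 0 needs separate care, as \<open>N / m\<close>
  is too large there.\<close>

lemma sum_hyperbolic_le:
  fixes F :: "nat \<Rightarrow> real"
  assumes "rat_approx \<alpha> h q" and nonneg: "\<And>m. 0 \<le> F m"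
    and A: "\<And>m. m \<ge> 1 \<Longrightarrow> F m \<le> real N / real m"
    and F: "\<And>m. F m * int_dist (real m * \<alpha>) \<le> 1"
    and H: "1 \<le> H" "harm M \<le> H" "harm (2 * q) \<le> H"
  shows "(\<Sum>m = 1..M. F m) \<le> 8 * H * (real q + real N / real q + real M)"
proof -
  define Q where "Q = q div 2 + 1"
  have q: "q \<ge> 1" "real q > 0" using assms by (auto simp: rat_approx_def)
  have Q: "real q / 2 \<le> real Q" "0 < Q" by (auto simp: Q_def)
  have first: "sum F {1..<Q} \<le> 2 * (2 * real q) + 4 * real q * H"
  proof -
    have "sum F {1..<Q} \<le> 2 * (2 * real q) + 4 * real q * harm (2 * q)"
    proof (rule sum_block_le[OF assms(1), of _ _ F 0])
      fix m assume m: "m \<in> {1..<Q}"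
      \<comment> \<open>Comparing \<open>m\<close> with 0 in the spacing lemma keeps
        \<open>m * \<alpha>\<close> away from all integers, so \<open>2 * q\<close> can serve as the
        uniform bound on the first block.\<close>
      have 1: "1 / (2 * real q) \<le> \<bar>of_int (int m) * \<alpha> - of_int z\<bar>" for z
        using m by (intro rat_approx_spacing[OF assms(1)]) (auto simp: Q_def)
      have "1 / (2 * real q) \<le> int_dist (real m * \<alpha>)"
        using 1[of "\<lfloor>real m * \<alpha>\<rfloor>"] 1[of "\<lfloor>real m * \<alpha>\<rfloor> + 1"] frac_lt_1[of "real m * \<alpha>"]
        by (simp add: int_dist_def frac_def)
      hence "F m * (1 / (2 * real q)) \<le> F m * int_dist (real m * \<alpha>)"
        using nonneg by (intro mult_left_mono) auto
      hence "F m * (1 / (2 * real q)) \<le> 1" using F[of m] by linarith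
      thus "F m \<le> 2 * real q" using q by (simp add: field_simps)
    qed (use F in \<open>auto simp: Q_def\<close>)
    also have "\<dots> \<le> 2 * (2 * real q) + 4 * real q * H"
      using H by (intro add_left_mono mult_left_mono) auto
    finally show ?thesis .
  qed
  have step: "sum F {t * Q..<Suc t * Q} \<le> 4 * (real N / real q) * (1 / real t) + 4 * real q * H" if "t \<ge> 1" for t
  proof -
    have tQ: "t * Q \<ge> 1" using that Q by simp
    have "sum F {t * Q..<Suc t * Q} \<le> 2 * (real N / real (t * Q)) + 4 * real q * harm (2 * q)"
    proof (rule sum_block_le[OF assms(1), of _ _ F 0])
      fix m assume m: "m \<in> {t * Q..<Suc t * Q}"
      hence "t * Q \<le> m" by simp
      hence m': "1 \<le> m" "real (t * Q) \<le> real m" using tQ by linarith+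
      have "F m \<le> real N / real m" using m' by (intro A) auto
      also have "\<dots> \<le> real N / real (t * Q)" 
        using m' tQ by (intro divide_left_mono mult_pos_pos; linarith)
      finally show "F m \<le> real N / real (t * Q)" .
    qed (use F in \<open>auto simp: Q_def\<close>)
    also have "real N / real (t * Q) = (real N / real t) / real Q" by simp
    also have "\<dots> \<le> (real N / real t) / (real q / 2)"
      using Q q by (intro divide_left_mono) auto
    also have "2 * ((real N / real t) / (real q / 2)) = 4 * (real N / real q) * (1 / real t)" by simp
    also have "4 * (real N / real q) * (1 / real t) + 4 * real q * harm (2 * q)
        \<le> 4 * (real N / real q) * (1 / real t) + 4 * real q * H"
      using H by (intro add_left_mono mult_left_mono) auto
    finally show ?thesis by simp
  qed
  have all: "sum F {1..<Suc t * Q} \<le> 4 * real q + 4 * real q * H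
      + 4 * (real N / real q) * harm t + real t * (4 * real q * H)" for t
  proof (induction t)
    case 0
    thus ?case using first by (simp add: harm_def)
  next
    case (Suc t)
    have "sum F {1..<Suc (Suc t) * Q} = sum F {1..<Suc t * Q} + sum F {Suc t * Q..<Suc (Suc t) * Q}"
      by (rule sum.atLeastLessThan_concat[symmetric]) (use Q in auto)
    thus ?case using Suc.IH step[of "Suc t"]
      by (simp add: harm_Suc inverse_eq_divide algebra_simps add_divide_distrib)
  qed
  define T where "T = M div Q"
  have M: "M < Suc T * Q"
    using Q(2) unfolding T_def by (metis dividend_less_times_div mult.commute mult_Suc add.commute)
  have "real T \<le> real M / real Q" unfolding T_def by (rule of_nat_div_le_of_nat)
  also have "\<dots> \<le> real M / (real q / 2)" using Q q by (intro divide_left_mono) auto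
  finally have T: "real T \<le> 2 * real M / real q" by (simp add: mult.commute)
  have hT: "harm T \<le> H" using harm_mono[of T M] H(2) unfolding T_def by (metis div_le_dividend order_trans)
  have "(\<Sum>m = 1..M. F m) \<le> sum F {1..<Suc T * Q}"
    using M nonneg by (intro sum_mono2) auto
  also have "\<dots> \<le> 4 * real q + 4 * real q * H + 4 * (real N / real q) * harm T + real T * (4 * real q * H)"
    by (rule all)
  also have "\<dots> \<le> 4 * real q * H + 4 * real q * H + 4 * (real N / real q) * H + (2 * real M / real q) * (4 * real q * H)"
    using H hT T q by (intro add_mono mult_left_mono mult_right_mono) auto
  also have "\<dots> = 8 * H * (real q + real N / real q + real M) - 4 * (H * (real N / real q))"
    using q by (simp add: field_simps)
  also have "\<dots> \<le> 8 * H * (real q + real N / real q + real M)"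
    using H q by simp
  finally show ?thesis .
qed

section \<open>Type I and type II sums\<close>

text \<open>Cauchy-Schwarz with the weights \<open>1 / sqrt m\<close> and \<open>sqrt m\<close>
  separates the coefficients from the inner geometric sums \<open>F m\<close>. As
  \<open>F m \<le> N / m\<close>, the second moment \<open>m * (F m)^2\<close> is at most
  \<open>N * F m\<close>, so that \<open>sum_hyperbolic_le\<close> applies.\<close>

lemma type_I_sum_le:
  fixes u :: "nat \<Rightarrow> complex"
  assumes "rat_approx \<alpha> h q" and u: "\<And>m. norm (u m) \<le> d m"
    and H: "1 \<le> H" "harm M \<le> H" "harm (2 * q) \<le> H"
  shows "(norm (\<Sum>m = 1..M. u m * (\<Sum>n = 1..N div m. e2pi (of_nat (m * n) * \<alpha>))))\<^sup>2
    \<le> (\<Sum>m = 1..M. (d m)\<^sup>2 / real m) * (real N * (8 * H * (real q + real N / real q + real M)))"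
proof -
  define F where "F m = norm (\<Sum>n = 1..N div m. e2pi (of_nat (m * n) * \<alpha>))" for m
  have F_eq: "F m = norm (\<Sum>n = 1..<Suc (N div m). e2pi (of_nat n * (real m * \<alpha>)))" for m
    unfolding F_def by (simp add: mult_ac atLeastLessThanSuc_atLeastAtMost)
  have F: "0 \<le> F m" "F m \<le> real N / real m" "F m * int_dist (real m * \<alpha>) \<le> 1" for m
  proof -
    show "0 \<le> F m" by (simp add: F_def)
    have "F m \<le> real (N div m)"
      unfolding F_eq by (rule order_trans[OF norm_sum_e2pi_le]) simp
    thus "F m \<le> real N / real m" using of_nat_div_le_of_nat order_trans by blast
    show "F m * int_dist (real m * \<alpha>) \<le> 1"
      unfolding F_eq by (rule norm_sum_e2pi_int_dist_le)
  qed
  have d: "0 \<le> d m" for m using u[of m] norm_ge_zero order_trans by blast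
  have "norm (\<Sum>m = 1..M. u m * (\<Sum>n = 1..N div m. e2pi (of_nat (m * n) * \<alpha>))) \<le> (\<Sum>m = 1..M. d m * F m)"
    by (rule order_trans[OF norm_sum]) (auto simp: norm_mult F_def intro!: sum_mono mult_right_mono u)
  also have "\<dots> = (\<Sum>m = 1..M. (d m / sqrt (real m)) * (F m * sqrt (real m)))"
    by (intro sum.cong) auto
  finally have "(norm (\<Sum>m = 1..M. u m * (\<Sum>n = 1..N div m. e2pi (of_nat (m * n) * \<alpha>))))\<^sup>2
      \<le> (\<Sum>m = 1..M. (d m / sqrt (real m)) * (F m * sqrt (real m)))\<^sup>2"
    by (intro power_mono) auto
  also have "\<dots> \<le> (\<Sum>m = 1..M. (d m / sqrt (real m))\<^sup>2) * (\<Sum>m = 1..M. (F m * sqrt (real m))\<^sup>2)"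
    by (rule Cauchy_Schwarz_ineq_sum)
  also have "(\<Sum>m = 1..M. (d m / sqrt (real m))\<^sup>2) = (\<Sum>m = 1..M. (d m)\<^sup>2 / real m)"
    by (simp add: power_divide)
  also have "(\<Sum>m = 1..M. (d m)\<^sup>2 / real m) * (\<Sum>m = 1..M. (F m * sqrt (real m))\<^sup>2)
     \<le> (\<Sum>m = 1..M. (d m)\<^sup>2 / real m) * (real N * (\<Sum>m = 1..M. F m))"
  proof (intro mult_left_mono sum_nonneg)
    have "(F m * sqrt (real m))\<^sup>2 \<le> real N * F m" if "m \<in> {1..M}" for m
    proof -
      have "(F m * sqrt (real m))\<^sup>2 = F m * (real m * F m)" by (simp add: power_mult_distrib power2_eq_square)
      also have "\<dots> \<le> F m * real N" using F(1,2)[of m] that by (intro mult_left_mono) (auto simp: field_simps)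
      finally show ?thesis by (simp add: mult.commute)
    qed
    thus "(\<Sum>m = 1..M. (F m * sqrt (real m))\<^sup>2) \<le> real N * (\<Sum>m = 1..M. F m)"
      unfolding sum_distrib_left by (rule sum_mono)
  qed simp
  also have "\<dots> \<le> (\<Sum>m = 1..M. (d m)\<^sup>2 / real m) * (real N * (8 * H * (real q + real N / real q + real M)))"
    by (intro mult_left_mono sum_hyperbolic_le[OF assms(1)] F H) (auto intro: sum_nonneg)
  finally show ?thesis .
qed

text \<open>Cauchy-Schwarz removes the coefficients \<open>u\<close>. Expanding the square and
  summing over \<open>m\<close> first leaves geometric sums \<open>G n1 n2\<close> with the phase
  \<open>(n1 - n2) * \<alpha>\<close>; for one of the two variables fixed,
  \<open>sum_interval_le\<close> bounds their total by \<open>W\<close>.\<close>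

lemma type_II_block_le:
  fixes u b :: "nat \<Rightarrow> complex" and M N :: nat
  assumes "rat_approx \<alpha> h q" and u: "\<And>m. norm (u m) \<le> 1" and "M \<ge> 1"
  defines "R \<equiv> N div M"
  shows "(norm (\<Sum>m = M..<2 * M. u m * (\<Sum>n = 1..N div m. b n * e2pi (of_nat (m * n) * \<alpha>))))\<^sup>2
    \<le> real M * ((\<Sum>n = 1..R. (norm (b n))\<^sup>2) *
        ((2 * real R / real q + 1) * (2 * real M + 4 * real q * harm (2 * q))))"
proof -
  define c where "c m = (\<Sum>n = 1..N div m. b n * e2pi (of_nat (m * n) * \<alpha>))" for m
  \<comment> \<open>The exclusive upper end of the range of \<open>m\<close> cut out by
    \<open>m < 2 * M\<close>, \<open>m * n1 \<le> N\<close> and \<open>m * n2 \<le> N\<close>; the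
    range is an interval, so its sum is geometric.\<close>
  define K where "K n1 n2 = min (2 * M) (min (Suc (N div n1)) (Suc (N div n2)))" for n1 n2
  define G where "G n1 n2 = (\<Sum>m = M..<K n1 n2. e2pi (of_nat m * ((real n1 - real n2) * \<alpha>)))" for n1 n2
  define W where "W = (2 * real R / real q + 1) * (2 * real M + 4 * real q * harm (2 * q))"
  \<comment> \<open>The inner range is made independent of \<open>m\<close>, which allows the order
    of summation to be changed.\<close>
  have c: "c m = (\<Sum>n = 1..R. if m * n \<le> N then b n * e2pi (of_nat (m * n) * \<alpha>) else 0)"
    if "m \<in> {M..<2 * M}" for m
  proof -
    have m: "m > 0" "M \<le> m" using that \<open>M \<ge> 1\<close> by auto
    hence "N div m \<le> R" unfolding R_def using \<open>M \<ge> 1\<close> by (intro div_le_mono2) auto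
    have iff: "m * n \<le> N \<longleftrightarrow> n \<le> N div m" for n
      using m by (simp add: less_eq_div_iff_mult_less_eq mult.commute)
    have "{n \<in> {1..R}. m * n \<le> N} = {1..N div m}"
      unfolding iff using \<open>N div m \<le> R\<close> by auto
    hence "c m = (\<Sum>n \<in> {n \<in> {1..R}. m * n \<le> N}. b n * e2pi (of_nat (m * n) * \<alpha>))"
      unfolding c_def by simp
    thus ?thesis by (simp only: sum.inter_filter finite_atLeastAtMost)
  qed
  have G: "(\<Sum>m = M..<2 * M. if m * n1 \<le> N \<and> m * n2 \<le> N then e2pi (of_nat m * ((real n1 - real n2) * \<alpha>)) else 0)
      = G n1 n2" if "n1 \<in> {1..R}" "n2 \<in> {1..R}" for n1 n2
  proof -
    have "{m \<in> {M..<2 * M}. m * n1 \<le> N \<and> m * n2 \<le> N} = {M..<K n1 n2}"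
      using that by (auto simp: K_def less_Suc_eq_le less_eq_div_iff_mult_less_eq)
    thus ?thesis unfolding G_def by (simp only: sum.inter_filter[symmetric] finite_atLeastLessThan)
  qed
  have cc: "complex_of_real ((norm (c m))\<^sup>2) = (\<Sum>n1 = 1..R. \<Sum>n2 = 1..R. b n1 * cnj (b n2) *
      (if m * n1 \<le> N \<and> m * n2 \<le> N then e2pi (of_nat m * ((real n1 - real n2) * \<alpha>)) else 0))"
    if "m \<in> {M..<2 * M}" for m
  proof -
    have "complex_of_real ((norm (c m))\<^sup>2) = c m * cnj (c m)" by (rule complex_norm_square)
    also have "\<dots> = (\<Sum>n1 = 1..R. \<Sum>n2 = 1..R.
        (if m * n1 \<le> N then b n1 * e2pi (of_nat (m * n1) * \<alpha>) else 0) *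
        cnj (if m * n2 \<le> N then b n2 * e2pi (of_nat (m * n2) * \<alpha>) else 0))"
      unfolding c[OF that] cnj_sum by (rule sum_product)
    also have "\<dots> = (\<Sum>n1 = 1..R. \<Sum>n2 = 1..R. b n1 * cnj (b n2) *
      (if m * n1 \<le> N \<and> m * n2 \<le> N then e2pi (of_nat m * ((real n1 - real n2) * \<alpha>)) else 0))"
    proof (intro sum.cong refl)
      fix n1 n2
      have "of_nat m * ((real n1 - real n2) * \<alpha>) = of_nat (m * n1) * \<alpha> + - (of_nat (m * n2) * \<alpha>)"
        by (simp add: algebra_simps)
      thus "(if m * n1 \<le> N then b n1 * e2pi (of_nat (m * n1) * \<alpha>) else 0) *
          cnj (if m * n2 \<le> N then b n2 * e2pi (of_nat (m * n2) * \<alpha>) else 0) =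
          b n1 * cnj (b n2) * (if m * n1 \<le> N \<and> m * n2 \<le> N
            then e2pi (of_nat m * ((real n1 - real n2) * \<alpha>)) else 0)"
        by (simp only: e2pi_add) (simp add: cnj_e2pi)
    qed
    finally show ?thesis .
  qed
  have "complex_of_real (\<Sum>m = M..<2 * M. (norm (c m))\<^sup>2) =
     (\<Sum>m = M..<2 * M. \<Sum>n1 = 1..R. \<Sum>n2 = 1..R. b n1 * cnj (b n2) *
      (if m * n1 \<le> N \<and> m * n2 \<le> N then e2pi (of_nat m * ((real n1 - real n2) * \<alpha>)) else 0))"
    unfolding of_real_sum by (intro sum.cong refl cc)
  also have "\<dots> = (\<Sum>n1 = 1..R. \<Sum>n2 = 1..R. \<Sum>m = M..<2 * M. b n1 * cnj (b n2) *
      (if m * n1 \<le> N \<and> m * n2 \<le> N then e2pi (of_nat m * ((real n1 - real n2) * \<alpha>)) else 0))"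
    by (subst sum.swap) (intro sum.cong refl sum.swap)
  also have "\<dots> = (\<Sum>n1 = 1..R. \<Sum>n2 = 1..R. b n1 * cnj (b n2) * G n1 n2)"
    unfolding sum_distrib_left[symmetric] by (intro sum.cong refl arg_cong2[where f = "(*)"] G)
  finally have eq: "complex_of_real (\<Sum>m = M..<2 * M. (norm (c m))\<^sup>2)
      = (\<Sum>n1 = 1..R. \<Sum>n2 = 1..R. b n1 * cnj (b n2) * G n1 n2)" .
  have "(\<Sum>m = M..<2 * M. (norm (c m))\<^sup>2) = norm (complex_of_real (\<Sum>m = M..<2 * M. (norm (c m))\<^sup>2))"
    unfolding norm_of_real by (rule abs_of_nonneg[symmetric]) (intro sum_nonneg zero_le_power2)
  also have "\<dots> = norm (\<Sum>n1 = 1..R. \<Sum>n2 = 1..R. b n1 * cnj (b n2) * G n1 n2)" by (simp only: eq)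
  also have "\<dots> \<le> (\<Sum>n1 = 1..R. \<Sum>n2 = 1..R. norm (b n1 * cnj (b n2) * G n1 n2))"
    by (rule order_trans[OF norm_sum]) (intro sum_mono norm_sum)
  \<comment> \<open>The product of the two coefficients is at most half the sum of their squares; in
    each resulting term one variable occurs only in \<open>G\<close> and can be summed
    freely.\<close>
  also have "\<dots> \<le> (\<Sum>n1 = 1..R. \<Sum>n2 = 1..R.
      (norm (b n1))\<^sup>2 * norm (G n1 n2) / 2 + (norm (b n2))\<^sup>2 * norm (G n1 n2) / 2)"
  proof (intro sum_mono)
    fix n1 n2
    have "norm (b n1) * norm (b n2) \<le> ((norm (b n1))\<^sup>2 + (norm (b n2))\<^sup>2) / 2"
      using sum_squares_bound[of "norm (b n1)" "norm (b n2)"] by simp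
    hence "norm (b n1) * norm (b n2) * norm (G n1 n2) \<le> ((norm (b n1))\<^sup>2 + (norm (b n2))\<^sup>2) / 2 * norm (G n1 n2)"
      by (rule mult_right_mono) simp
    thus "norm (b n1 * cnj (b n2) * G n1 n2)
        \<le> (norm (b n1))\<^sup>2 * norm (G n1 n2) / 2 + (norm (b n2))\<^sup>2 * norm (G n1 n2) / 2"
      by (simp add: norm_mult algebra_simps add_divide_distrib)
  qed
  also have "\<dots> = (\<Sum>n1 = 1..R. (norm (b n1))\<^sup>2 * (\<Sum>n2 = 1..R. norm (G n1 n2))) / 2
      + (\<Sum>n2 = 1..R. (norm (b n2))\<^sup>2 * (\<Sum>n1 = 1..R. norm (G n1 n2))) / 2"
  proof -
    have swap: "(\<Sum>n1 = 1..R. \<Sum>n2 = 1..R. (norm (b n2))\<^sup>2 * norm (G n1 n2) / 2)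
        = (\<Sum>n2 = 1..R. \<Sum>n1 = 1..R. (norm (b n2))\<^sup>2 * norm (G n1 n2) / 2)"
      by (rule sum.swap)
    show ?thesis by (simp only: sum.distrib sum_distrib_left sum_divide_distrib swap)
  qed
  also have "\<dots> \<le> (\<Sum>n1 = 1..R. (norm (b n1))\<^sup>2 * W) / 2 + (\<Sum>n2 = 1..R. (norm (b n2))\<^sup>2 * W) / 2"
  proof (intro add_mono divide_right_mono sum_mono mult_left_mono)
    have G1: "norm (G n1 n2) \<le> real M" for n1 n2
      unfolding G_def by (rule order_trans[OF norm_sum_e2pi_le]) (auto simp: K_def)
    have G2: "norm (G n1 n2) * int_dist ((real n1 - real n2) * \<alpha>) \<le> 1" for n1 n2
      unfolding G_def by (rule norm_sum_e2pi_int_dist_le)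
    show "(\<Sum>n1 = 1..R. norm (G n1 n2)) \<le> W" for n2
      using sum_interval_le[OF assms(1), of "real M" 1 R "\<lambda>n1. norm (G n1 n2)" "- real n2 * \<alpha>"]
        G1 G2[of _ n2] by (simp add: W_def atLeastLessThanSuc_atLeastAtMost left_diff_distrib)
    have "int_dist ((real n1 - real n2) * \<alpha>) = int_dist (real n2 * \<alpha> - real n1 * \<alpha>)" for n1 n2
      using int_dist_minus[of "(real n1 - real n2) * \<alpha>"] by (simp add: algebra_simps)
    thus "(\<Sum>n2 = 1..R. norm (G n1 n2)) \<le> W" for n1
      using sum_interval_le[OF assms(1), of "real M" 1 R "\<lambda>n2. norm (G n1 n2)" "- real n1 * \<alpha>"]
        G1 G2[of n1] by (simp add: W_def atLeastLessThanSuc_atLeastAtMost)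
  qed auto
  also have "\<dots> = (\<Sum>n = 1..R. (norm (b n))\<^sup>2) * W"
    by (simp add: sum_distrib_right)
  finally have main: "(\<Sum>m = M..<2 * M. (norm (c m))\<^sup>2) \<le> (\<Sum>n = 1..R. (norm (b n))\<^sup>2) * W" .
  have "norm (\<Sum>m = M..<2 * M. u m * c m) \<le> (\<Sum>m = M..<2 * M. norm (u m) * norm (c m))"
    by (rule order_trans[OF norm_sum]) (simp add: norm_mult)
  also have "\<dots> \<le> (\<Sum>m = M..<2 * M. 1 * norm (c m))"
    by (intro sum_mono mult_right_mono u) auto
  finally have "(norm (\<Sum>m = M..<2 * M. u m * c m))\<^sup>2 \<le> (\<Sum>m = M..<2 * M. 1 * norm (c m))\<^sup>2"
    by (intro power_mono) auto
  also have "\<dots> \<le> (\<Sum>m = M..<2 * M. 1\<^sup>2) * (\<Sum>m = M..<2 * M. (norm (c m))\<^sup>2)"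
    by (rule Cauchy_Schwarz_ineq_sum)
  also have "\<dots> \<le> real M * ((\<Sum>n = 1..R. (norm (b n))\<^sup>2) * W)"
    using main by (simp add: mult_left_mono)
  finally show ?thesis unfolding c_def W_def .
qed

lemma sum_dyadic:
  fixes F :: "nat \<Rightarrow> 'a :: comm_monoid_add"
  shows "sum F {1..<2 ^ J} = (\<Sum>i<J. sum F {2 ^ i..<2 * 2 ^ i})"
proof (induction J)
  case (Suc J)
  have "sum F {1..<2 ^ Suc J} = sum F {1..<2 ^ J} + sum F {2 ^ J..<2 * 2 ^ J}"
    by (simp add: sum.atLeastLessThan_concat)
  thus ?case using Suc by simp
qed simp

text \<open>The variable \<open>m\<close> is split into \<open>J\<close> dyadic blocks. The support
  conditions leave only blocks in which both \<open>M\<close> and \<open>N div M\<close> are at most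
  a constant times \<open>N / V\<close>, and there \<open>type_II_block_le\<close> gives a bound
  uniform in \<open>M\<close>.\<close>

lemma type_II_sum_le:
  fixes u b :: "nat \<Rightarrow> complex"
  assumes "rat_approx \<alpha> h q" and u: "\<And>m. norm (u m) \<le> 1" "\<And>m. real m \<le> V \<Longrightarrow> u m = 0"
    and b: "\<And>n. real n \<le> V \<Longrightarrow> b n = 0" "\<And>R. R \<le> N \<Longrightarrow> (\<Sum>n = 1..R. (norm (b n))\<^sup>2) \<le> real R * D"
    and V: "0 < V" and D: "0 \<le> D" and J: "N < 2 ^ J" and H: "1 \<le> H" "harm (2 * q) \<le> H"
  shows "norm (\<Sum>m = 1..N. u m * (\<Sum>n = 1..N div m. b n * e2pi (of_nat (m * n) * \<alpha>)))
    \<le> real J * sqrt (18 * H * D * (real N * (real N / real q + real N / V + real q)))"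
proof -
  define F where "F m = u m * (\<Sum>n = 1..N div m. b n * e2pi (of_nat (m * n) * \<alpha>))" for m
  define E where "E = 18 * H * D * (real N * (real N / real q + real N / V + real q))"
  have q: "real q > 0" using assms(1) by (auto simp: rat_approx_def)
  have E: "0 \<le> E" unfolding E_def using H V D q by (intro mult_nonneg_nonneg add_nonneg_nonneg) auto
  have block: "norm (sum F {M..<2 * M}) \<le> sqrt E" if "M \<ge> 1" for M
  \<comment> \<open>In the first case every \<open>m\<close> of the block, or every admissible
    \<open>n\<close>, is at most \<open>V\<close>, and the block vanishes.\<close>
  proof (cases "real (2 * M) \<le> V \<or> real (N div M) \<le> V")
    case True
    have "F m = 0" if m: "m \<in> {M..<2 * M}" for m
    proof (cases "real (2 * M) \<le> V")
      case False
      have "N div m \<le> N div M" using m \<open>M \<ge> 1\<close> by (intro div_le_mono2) auto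
      hence "b n = 0" if "n \<in> {1..N div m}" for n
        using that True False by (intro b) auto
      thus ?thesis by (simp add: F_def)
    qed (use m u(2)[of m] in \<open>auto simp: F_def\<close>)
    thus ?thesis using E by simp
  next
    case False
    define R where "R = N div M"
    have MR: "real M * real R \<le> real N"
      by (metis R_def of_nat_mult of_nat_mono times_div_less_eq_dividend)
    have "V * real M \<le> real R * real M" using False by (intro mult_right_mono) (auto simp: R_def)
    hence M: "real M \<le> real N / V" using MR V by (simp add: field_simps)
    have "V * real R \<le> (2 * real M) * real R" using False by (intro mult_right_mono) auto
    hence R: "real R \<le> 2 * (real N / V)" using MR V by (simp add: field_simps)
    have "(norm (sum F {M..<2 * M}))\<^sup>2 \<le> real M * ((\<Sum>n = 1..R. (norm (b n))\<^sup>2) *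
        ((2 * real R / real q + 1) * (2 * real M + 4 * real q * harm (2 * q))))"
      unfolding F_def R_def by (rule type_II_block_le[OF assms(1) u(1) that])
    also have "\<dots> \<le> real M * ((real R * D) * ((2 * real R / real q + 1) * (2 * real M + 4 * real q * H)))"
    proof (intro mult_left_mono mult_mono)
      show "(\<Sum>n = 1..R. (norm (b n))\<^sup>2) \<le> real R * D" by (intro b) (simp add: R_def)
      show "2 * real M + 4 * real q * harm (2 * q) \<le> 2 * real M + 4 * real q * H"
        using H by (intro add_left_mono mult_left_mono) auto
    qed (use D in \<open>auto simp: harm_nonneg\<close>)
    also have "\<dots> = (real M * real R) * (D * (4 * ((real M * real R) / real q) + 8 * (H * real R) + 2 * real M + 4 * (H * real q)))"
      using q by (simp add: field_simps)
    \<comment> \<open>The constant is 16 + 2, from \<open>8 * H * R \<le> 16 * H * N / V\<close> and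
      \<open>2 * M \<le> 2 * H * N / V\<close>; the other two terms have room to spare.\<close>
    also have "\<dots> \<le> real N * (D * (18 * (H * (real N / real q)) + 18 * (H * (real N / V)) + 18 * (H * real q)))"
    proof (intro mult_mono MR order_refl D)
      have "(real M * real R) / real q \<le> real N / real q" using MR q by (intro divide_right_mono) auto
      moreover have "1 * (real N / real q) \<le> H * (real N / real q)" using H q by (intro mult_right_mono) auto
      moreover have "H * real R \<le> H * (2 * (real N / V))" using R H by (intro mult_left_mono) auto
      moreover have "1 * (real N / V) \<le> H * (real N / V)" using H V by (intro mult_right_mono) auto
      moreover have "0 \<le> H * real q" "0 \<le> real N / real q" using H q by auto
      ultimately show "4 * ((real M * real R) / real q) + 8 * (H * real R) + 2 * real M + 4 * (H * real q)
          \<le> 18 * (H * (real N / real q)) + 18 * (H * (real N / V)) + 18 * (H * real q)"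
        using M by linarith
    qed (use H q D in auto)
    also have "\<dots> = E" by (simp add: E_def algebra_simps)
    finally show ?thesis by (rule real_le_rsqrt)
  qed
  have "(\<Sum>m = 1..N. F m) = sum F {1..<2 ^ J}"
    using J by (intro sum.mono_neutral_left) (auto simp: F_def)
  also have "\<dots> = (\<Sum>i<J. sum F {2 ^ i..<2 * 2 ^ i})" by (rule sum_dyadic)
  also have "norm \<dots> \<le> (\<Sum>i<J. sqrt E)"
    by (intro order_trans[OF norm_sum] sum_mono block) auto
  finally show ?thesis by (simp add: F_def E_def)
qed

section \<open>Bounds for the Moebius exponential sum\<close>

text \<open>The difference \<open>harm n - ln n\<close> is decreasing and equals 1 at
  \<open>n = 1\<close>.\<close>

lemma harm_le_ln:
  assumes "n \<ge> 1" shows "harm n \<le> 1 + ln (real n)"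
proof -
  obtain m where m: "n = Suc m" using assms by (cases n) auto
  have "harm (Suc m) - ln (real (Suc m)) \<le> harm (Suc 0) - ln (real (Suc 0))"
    using decseqD[OF decseq_harm_diff_ln, of 0 m] by simp
  thus ?thesis by (simp add: m harm_def)
qed

lemma one_le_harm: "n \<ge> 1 \<Longrightarrow> 1 \<le> (harm n :: real)"
  using harm_mono[of 1 n, where 'a = real] by (simp add: harm_def)

lemma norm_of_int_le: "\<bar>i\<bar> \<le> j \<Longrightarrow> norm (of_int i :: complex) \<le> of_int j"
  by (simp add: norm_of_int)

lemma norm_sum_coef_le:
  assumes "f \<preceq> h"
  shows "norm (\<Sum>n = 1..N. of_int (coef f n) * e2pi (x n)) \<le> (\<Sum>n = 1..N. of_int (coef h n))"
proof (rule sum_norm_le)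
  fix n
  show "norm (of_int (coef f n) * e2pi (x n)) \<le> of_int (coef h n)"
    using norm_of_int_le[OF majorizedD[OF assms, of n]] by (simp only: norm_mult norm_e2pi mult_1_right)
qed

lemma norm_sum_moebius_conv_trivial:
  "norm (\<Sum>n = 1..N. of_int (coef (mu ^ k) n) * e2pi (x n)) \<le> real N * harm N ^ k"
  by (rule order_trans[OF norm_sum_coef_le sum_zeta_power_le])
    (intro majorized_power mu_majorized_zeta)

text \<open>Factor by factor: \<open>1 - trunc V mu * zeta\<close> is dominated by
  \<open>2 * zeta ^ 2\<close>, and the \<open>j\<close>-th summand by
  \<open>(j + 1) * zeta ^ (k - 1)\<close> whatever \<open>j\<close> is.\<close>

lemma type_II_coef_majorized:
  "(1 - trunc V mu * zeta) * (\<Sum>j<k. of_nat (j + 1) * (trunc V mu ^ j * mu ^ (k - 1 - j)))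
    \<preceq> of_nat (2 * (\<Sum>j<k. j + 1)) * zeta ^ (k + 1)"
proof -
  have g: "trunc V mu \<preceq> zeta" by (intro majorized_trunc mu_majorized_zeta)
  have w: "1 - trunc V mu * zeta \<preceq> zeta ^ 2 + zeta ^ 2"
    using zeta_power_mono[of 0 2] majorized_mult[OF g zeta_majorized]
    by (intro majorized_diff) (simp_all add: power2_eq_square)
  have P: "(\<Sum>j<k. of_nat (j + 1) * (trunc V mu ^ j * mu ^ (k - 1 - j)))
      \<preceq> (\<Sum>j<k. of_nat (j + 1) * (zeta ^ j * zeta ^ (k - 1 - j)))"
    by (intro majorized_sum majorized_of_nat_mult majorized_mult majorized_power g mu_majorized_zeta)
  have "(\<Sum>j<k. of_nat (j + 1) * (zeta ^ j * zeta ^ (k - 1 - j)))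
      = (\<Sum>j<k. of_nat (j + 1) * zeta ^ (k - 1))"
    unfolding power_add[symmetric] by (intro sum.cong refl) simp
  also have "\<dots> = of_nat (\<Sum>j<k. j + 1) * zeta ^ (k - 1)"
    by (simp only: of_nat_sum sum_distrib_right)
  finally have "(1 - trunc V mu * zeta) * (\<Sum>j<k. of_nat (j + 1) * (trunc V mu ^ j * mu ^ (k - 1 - j)))
    \<preceq> (zeta ^ 2 + zeta ^ 2) * (of_nat (\<Sum>j<k. j + 1) * zeta ^ (k - 1))"
    using majorized_mult[OF w P] by (simp only:)
  also have "(zeta ^ 2 + zeta ^ 2) * (of_nat (\<Sum>j<k. j + 1) * zeta ^ (k - 1))
      = of_nat (2 * (\<Sum>j<k. j + 1)) * zeta ^ (k + 1)"
  proof (cases k)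
    case (Suc l)
    have "zeta ^ (k + 1) = zeta ^ 2 * zeta ^ (k - 1)" by (simp add: Suc flip: power_add)
    thus ?thesis by (simp only: mult_2 of_nat_add distrib_right distrib_left mult_ac)
  qed simp
  finally show ?thesis .
qed

text \<open>\<open>power_inverse_identity\<close> is applied with \<open>y = mu\<close>,
  \<open>z = zeta\<close> and \<open>g = trunc V mu\<close>, and its three parts are bounded by
  \<open>T1\<close>, \<open>T2\<close>, \<open>T3\<close>. The choice \<open>V ^ (k + 2) = N\<close>
  makes the support bound \<open>V ^ (k + 1)\<close> of \<open>g ^ (k + 1)\<close> equal to
  \<open>N / V\<close>, the same quantity that the type II sum produces. The single \<open>H\<close>
  dominates \<open>harm N\<close> and \<open>harm (2 * q)\<close>, and the leading constant is the
  sum of \<open>k + 1\<close>, \<open>3 * k\<close> and \<open>10 * c\<close>.\<close>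

lemma norm_sum_moebius_conv_le_sqrt:
  assumes k: "k \<ge> 2" and approx: "rat_approx \<alpha> h q" and "q \<le> N"
  defines "V \<equiv> real N powr (1 / real (k + 2))" and "H \<equiv> harm (2 * N)"
  shows "norm (\<Sum>n = 1..N. of_int (coef (mu ^ k) n) * e2pi (of_nat n * \<alpha>))
    \<le> real (4 * k + 1 + 20 * (\<Sum>j<k. j + 1)) * H ^ (k\<^sup>2 + 2) *
      sqrt (real N * (real N / real q + real N / V + real q))"
proof -
  define g where "g = trunc V mu"
  define P where "P = (\<Sum>j<k. of_nat (j + 1) * (g ^ j * mu ^ (k - 1 - j)))"
  define Y where "Y = real N * (real N / real q + real N / V + real q)"
  define S where "S f = (\<Sum>n = 1..N. of_int (coef f n) * e2pi (of_nat n * \<alpha>))" for f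
  define c where "c = 2 * (\<Sum>j<k. j + 1)"
  have q: "1 \<le> q" "real q > 0" using approx by (auto simp: rat_approx_def)
  have N: "N \<ge> 1" "real N \<ge> 1" using q \<open>q \<le> N\<close> by auto
  have H1: "1 \<le> H" unfolding H_def using N by (intro one_le_harm) auto
  have HN: "harm N \<le> H" unfolding H_def by (intro harm_mono) auto
  have Hq: "harm (2 * q) \<le> H" unfolding H_def using \<open>q \<le> N\<close> by (intro harm_mono) auto
  have V: "1 \<le> V" unfolding V_def using N by (intro ge_one_powr_ge_zero) auto
  have VN: "V ^ (k + 2) = real N"
  proof -
    have "V ^ (k + 2) = V powr real (k + 2)" using V by (intro powr_realpow[symmetric]) auto
    thus ?thesis unfolding V_def powr_powr by simp
  qed
  have Y: "0 \<le> Y" unfolding Y_def using q V by (intro mult_nonneg_nonneg add_nonneg_nonneg) auto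
  have VNY: "real N * (real N / V) \<le> Y" unfolding Y_def using q V by (intro mult_left_mono) auto
  have NV: "real N / V = V ^ (k + 1)" using VN V by (simp add: field_simps)
  have powH: "H ^ i \<le> H ^ j" if "i \<le> j" for i j using H1 that by (intro power_increasing)
  have kk: "2 * k \<le> k\<^sup>2" unfolding power2_eq_square using k by (intro mult_right_mono) auto
  \<comment> \<open>The power of \<open>H\<close> under the root comes from the mean square of
    \<open>zeta ^ (k + 1)\<close> and one further logarithm. The exponent comparison is
    \<open>2 * k \<le> k^2\<close>, true for \<open>k \<ge> 2\<close>.\<close>
  have H_half: "sqrt (H * H ^ ((k + 1) * (k + 1))) \<le> H ^ (k\<^sup>2 + 1)"
  proof (rule real_le_lsqrt)
    have "H * H ^ ((k + 1) * (k + 1)) = H ^ ((k + 1) * (k + 1) + 1)" by simp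
    also have "\<dots> \<le> H ^ (2 * (k\<^sup>2 + 1))" using kk unfolding power2_eq_square
      by (intro powH) (simp only: distrib_left distrib_right mult_1 mult_1_right)
    also have "\<dots> = (H ^ (k\<^sup>2 + 1))\<^sup>2" by (simp only: power_mult[symmetric] mult.commute)
    finally show "H * H ^ ((k + 1) * (k + 1)) \<le> (H ^ (k\<^sup>2 + 1))\<^sup>2" .
  qed (use H1 in auto)

  have g: "g \<preceq> zeta" unfolding g_def by (intro majorized_trunc mu_majorized_zeta)

  \<comment> \<open>The support lies in \<open>n \<le> V ^ k\<close>, so each term can be weighted
    by \<open>V ^ k / n\<close>; then \<open>V ^ (2 * k)\<close> is smaller than
    \<open>V ^ (2 * k + 3)\<close>, which is \<open>N * (N / V)\<close>.\<close>
  have T1: "norm (S (g ^ k)) \<le> H ^ (k\<^sup>2 + 2) * sqrt Y"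
  proof -
    have "norm (S (g ^ k)) \<le> (\<Sum>n = 1..N. V ^ k * (of_int (coef (zeta ^ k) n) / real n))"
      unfolding S_def
    proof (rule order_trans[OF norm_sum], rule sum_mono)
      fix n assume n: "n \<in> {1..N}"
      show "norm (of_int (coef (g ^ k) n) * e2pi (of_nat n * \<alpha>)) \<le> V ^ k * (of_int (coef (zeta ^ k) n) / real n)"
      proof (cases "real n > V ^ k")
        case True
        thus ?thesis using coef_trunc_power_eq_0[of V k n mu] V coef_zeta_power_nonneg[of k n]
          by (simp add: g_def)
      next
        case False
        have "norm (of_int (coef (g ^ k) n) :: complex) \<le> of_int (coef (zeta ^ k) n)"
          by (intro norm_of_int_le majorizedD majorized_power g)
        also have "\<dots> = real n * (of_int (coef (zeta ^ k) n) / real n)" using n by simp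
        also have "\<dots> \<le> V ^ k * (of_int (coef (zeta ^ k) n) / real n)"
          using False by (intro mult_right_mono) (auto simp: coef_zeta_power_nonneg)
        finally show ?thesis by (simp add: norm_mult)
      qed
    qed
    also have "\<dots> \<le> V ^ k * harm N ^ k"
      unfolding sum_distrib_left[symmetric] using V by (intro mult_left_mono sum_zeta_power_div_le) auto
    also have "\<dots> \<le> V ^ k * H ^ (k\<^sup>2 + 2)"
      using V kk by (intro mult_left_mono order_trans[OF power_mono[OF HN] powH]) (auto simp: harm_nonneg)
    also have "V ^ k \<le> sqrt Y"
    proof (rule real_le_rsqrt)
      have "(V ^ k)\<^sup>2 = V ^ (2 * k)" by (simp add: power_mult[symmetric] mult.commute)
      also have "\<dots> \<le> V ^ (k + 2 + (k + 1))" using V by (intro power_increasing) auto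
      also have "\<dots> = real N * (real N / V)" unfolding NV by (simp only: power_add VN[symmetric])
      finally show "(V ^ k)\<^sup>2 \<le> Y" using VNY by linarith
    qed
    hence "V ^ k * H ^ (k\<^sup>2 + 2) \<le> sqrt Y * H ^ (k\<^sup>2 + 2)"
      using H1 by (intro mult_right_mono) auto
    finally show ?thesis by (simp add: mult.commute)
  qed

  \<comment> \<open>The factor \<open>zeta\<close> gives a smooth inner sum, and the support of
    \<open>g ^ (k + 1)\<close> shortens the outer one to \<open>M \<le> N / V\<close>: a type I
    sum.\<close>
  have T2: "norm (S (g ^ (k + 1) * zeta)) \<le> 3 * H ^ (k\<^sup>2 + 2) * sqrt Y"
  proof -
    define M where "M = min N (nat \<lfloor>V ^ (k + 1)\<rfloor>)"
    define D where "D = (\<Sum>m = 1..M. (of_int (coef (zeta ^ (k + 1)) m))\<^sup>2 / real m)"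
    have "real (nat \<lfloor>V ^ (k + 1)\<rfloor>) \<le> V ^ (k + 1)" using V by (intro of_nat_floor) auto
    hence M: "M \<le> N" "real M \<le> real N / V" unfolding NV M_def by auto
    have "S (g ^ (k + 1) * zeta) = (\<Sum>m = 1..N. of_int (coef (g ^ (k + 1)) m) *
        (\<Sum>n = 1..N div m. of_int (coef zeta n) * e2pi (of_nat (m * n) * \<alpha>)))"
      unfolding S_def by (rule sum_coef_mult)
    also have "\<dots> = (\<Sum>m = 1..N. of_int (coef (g ^ (k + 1)) m) *
        (\<Sum>n = 1..N div m. e2pi (of_nat (m * n) * \<alpha>)))"
      by (intro sum.cong arg_cong2[where f = "(*)"]) (auto simp: coef_zeta)
    also have "\<dots> = (\<Sum>m = 1..M. of_int (coef (g ^ (k + 1)) m) *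
        (\<Sum>n = 1..N div m. e2pi (of_nat (m * n) * \<alpha>)))"
    proof (intro sum.mono_neutral_right ballI)
      fix m assume "m \<in> {1..N} - {1..M}"
      hence "nat \<lfloor>V ^ (k + 1)\<rfloor> < m" by (auto simp: M_def)
      hence "V ^ (k + 1) < real m" by linarith
      hence "coef (g ^ (k + 1)) m = 0" unfolding g_def using V by (intro coef_trunc_power_eq_0) auto
      thus "of_int (coef (g ^ (k + 1)) m) * (\<Sum>n = 1..N div m. e2pi (of_nat (m * n) * \<alpha>)) = 0" by simp
    qed (auto simp: M_def)
    finally have S_eq: "S (g ^ (k + 1) * zeta) = (\<Sum>m = 1..M. of_int (coef (g ^ (k + 1)) m) *
        (\<Sum>n = 1..N div m. e2pi (of_nat (m * n) * \<alpha>)))" .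
    have "(norm (S (g ^ (k + 1) * zeta)))\<^sup>2 \<le> D * (real N * (8 * H * (real q + real N / real q + real M)))"
      unfolding S_eq D_def
    proof (rule type_I_sum_le[OF approx _ H1 _ Hq])
      show "norm (of_int (coef (g ^ (k + 1)) m) :: complex) \<le> of_int (coef (zeta ^ (k + 1)) m)" for m
        by (intro norm_of_int_le majorizedD majorized_power g)
      show "harm M \<le> H" by (rule order_trans[OF harm_mono[OF M(1)] HN])
    qed
    also have "\<dots> \<le> H ^ ((k + 1) * (k + 1)) * (real N * (8 * H * (real q + real N / real q + real N / V)))"
    proof (intro mult_mono mult_left_mono add_left_mono M)
      show "D \<le> H ^ ((k + 1) * (k + 1))"
        unfolding D_def using order_trans[OF harm_mono[OF M(1)] HN]
        by (intro order_trans[OF sum_zeta_power_sq_div_le] power_mono harm_nonneg)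
    qed (use H1 q in auto)
    also have "\<dots> = 8 * (H * H ^ ((k + 1) * (k + 1)) * Y)" by (simp add: Y_def algebra_simps)
    \<comment> \<open>The constant 8 is rounded up to a square; the same is done with 18 and 25 in
      \<open>T3\<close>.\<close>
    also have "\<dots> \<le> 9 * (H * H ^ ((k + 1) * (k + 1)) * Y)"
      using H1 Y by (intro mult_right_mono mult_nonneg_nonneg) auto
    finally have "norm (S (g ^ (k + 1) * zeta)) \<le> sqrt (9 * (H * H ^ ((k + 1) * (k + 1)) * Y))"
      by (rule real_le_rsqrt)
    also have "\<dots> = 3 * sqrt (H * H ^ ((k + 1) * (k + 1))) * sqrt Y"
      by (simp only: real_sqrt_mult) simp
    also have "\<dots> \<le> 3 * H ^ (k\<^sup>2 + 2) * sqrt Y"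
      using order_trans[OF H_half powH[of "k\<^sup>2 + 1" "k\<^sup>2 + 2"]] Y
      by (intro mult_right_mono mult_left_mono) auto
    finally show ?thesis .
  qed

  \<comment> \<open>Both factors vanish up to \<open>V\<close>, so this is a type II sum. The number
    \<open>J\<close> of dyadic blocks costs one more \<open>H\<close> beyond \<open>H_half\<close>,
    since \<open>J * ln 2 \<le> H\<close> and \<open>ln 2\<close> exceeds 1/2.\<close>
  have T3: "norm (S ((mu - g) * ((1 - g * zeta) * P))) \<le> 10 * real c * H ^ (k\<^sup>2 + 2) * sqrt Y"
  proof -
    define b where "b n = (of_int (coef ((1 - g * zeta) * P) n) :: complex)" for n
    define D where "D = (real c)\<^sup>2 * H ^ ((k + 1) * (k + 1))"
    obtain j where j: "2 ^ j \<le> N" "N < 2 ^ (j + 1)" using ex_power_ivl1[of 2 N] N by auto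
    define J where "J = j + 1"
    have "real J * ln 2 = ln (real (2 ^ J))" by (simp add: ln_realpow)
    also have "\<dots> \<le> ln (real (2 * N) + 1)" 
    proof (subst ln_le_cancel_iff)
      have "2 ^ J \<le> 2 * N" using j by (simp add: J_def)
      hence "real (2 ^ J) \<le> real (2 * N)" by (simp only: of_nat_le_iff)
      thus "real (2 ^ J) \<le> real (2 * N) + 1" by linarith
    qed auto
    also have "\<dots> \<le> H" unfolding H_def by (rule ln_le_harm)
    finally have "real J * ln 2 \<le> H" .
    moreover have "real J * (1 / 2) \<le> real J * ln 2"
      using ln2_ge_two_thirds by (intro mult_left_mono) auto
    ultimately have J: "real J \<le> 2 * H" by linarith
    have maj: "(1 - g * zeta) * P \<preceq> of_nat c * zeta ^ (k + 1)"
      unfolding g_def P_def c_def by (rule type_II_coef_majorized)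
    have b_le: "norm (b n) \<le> real c * of_int (coef (zeta ^ (k + 1)) n)" for n
      using norm_of_int_le[OF majorizedD[OF maj, of n]] by (simp add: b_def coef_of_nat_mult)
    have b_sum: "(\<Sum>n = 1..R. (norm (b n))\<^sup>2) \<le> real R * D" if "R \<le> N" for R
    proof -
      have "(\<Sum>n = 1..R. (norm (b n))\<^sup>2) \<le> (\<Sum>n = 1..R. (real c)\<^sup>2 * (of_int (coef (zeta ^ (k + 1)) n))\<^sup>2)"
        unfolding power_mult_distrib[symmetric] by (intro sum_mono power_mono b_le) auto
      also have "\<dots> = (real c)\<^sup>2 * (\<Sum>n = 1..R. (of_int (coef (zeta ^ (k + 1)) n))\<^sup>2)"
        by (rule sum_distrib_left[symmetric])
      also have "\<dots> \<le> (real c)\<^sup>2 * (real R * H ^ ((k + 1) * (k + 1)))"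
        using order_trans[OF harm_mono[OF that] HN]
        by (intro mult_left_mono order_trans[OF sum_le_of_sum_div]
            order_trans[OF sum_zeta_power_sq_div_le] power_mono harm_nonneg) auto
      finally show ?thesis by (simp add: D_def mult_ac)
    qed
    have "S ((mu - g) * ((1 - g * zeta) * P)) = (\<Sum>m = 1..N. of_int (coef (mu - g) m) *
        (\<Sum>n = 1..N div m. b n * e2pi (of_nat (m * n) * \<alpha>)))"
      unfolding S_def b_def by (rule sum_coef_mult)
    also have "norm \<dots> \<le> real J * sqrt (18 * H * D * Y)"
      unfolding Y_def
    proof (rule type_II_sum_le[OF approx])
      show "norm (of_int (coef (mu - g) m) :: complex) \<le> 1" for m
        using norm_of_int_le[of "coef (mu - g) m" "coef zeta m"]
          majorizedD[OF majorized_diff_trunc[OF mu_majorized_zeta], of V m]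
        by (auto simp: g_def coef_zeta split: if_splits)
      show "of_int (coef (mu - g) m) = (0 :: complex)" if "real m \<le> V" for m
        using that by (simp add: g_def coef_diff coef_trunc)
      show "b n = 0" if "real n \<le> V" for n
        unfolding b_def g_def
        using coef_mult_eq_0_le[of V "1 - trunc V mu * zeta" n P] coef_one_minus_trunc_mu_zeta that by simp
      show "N < 2 ^ J" using j by (simp add: J_def)
    qed (use V H1 Hq b_sum in \<open>auto simp: D_def\<close>)
    also have "\<dots> \<le> (2 * H) * sqrt (25 * ((real c)\<^sup>2 * (H * H ^ ((k + 1) * (k + 1)) * Y)))"
    proof (rule mult_mono[OF J real_sqrt_le_mono])
      have "18 * H * D * Y = 18 * ((real c)\<^sup>2 * (H * H ^ ((k + 1) * (k + 1)) * Y))"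
        by (simp add: D_def mult_ac)
      also have "\<dots> \<le> 25 * ((real c)\<^sup>2 * (H * H ^ ((k + 1) * (k + 1)) * Y))"
        using H1 Y by (intro mult_right_mono mult_nonneg_nonneg) auto
      finally show "18 * H * D * Y \<le> 25 * ((real c)\<^sup>2 * (H * H ^ ((k + 1) * (k + 1)) * Y))" .
    qed (use H1 Y in \<open>auto simp: D_def\<close>)
    also have "\<dots> = 10 * real c * (H * sqrt (H * H ^ ((k + 1) * (k + 1)))) * sqrt Y"
      by (simp only: real_sqrt_mult) simp
    also have "\<dots> \<le> 10 * real c * (H * H ^ (k\<^sup>2 + 1)) * sqrt Y"
      using H_half H1 Y by (intro mult_right_mono mult_left_mono) auto
    finally show ?thesis by simp
  qed

  have "S (mu ^ k) = of_nat (k + 1) * S (g ^ k) - of_nat k * S (g ^ (k + 1) * zeta)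
      + S ((mu - g) * ((1 - g * zeta) * P))"
    unfolding power_inverse_identity[OF mu_zeta, of k g, folded P_def] S_def
    by (simp only: coef_add coef_diff coef_of_nat_mult of_int_add of_int_diff of_int_mult of_int_of_nat_eq
        distrib_right left_diff_distrib sum.distrib sum_subtractf sum_distrib_left mult.assoc)
  hence "norm (S (mu ^ k)) \<le> norm (of_nat (k + 1) * S (g ^ k)) + norm (of_nat k * S (g ^ (k + 1) * zeta))
      + norm (S ((mu - g) * ((1 - g * zeta) * P)))"
    by (metis (no_types, lifting) norm_triangle_ineq norm_triangle_ineq4 add_right_mono order_trans)
  also have "\<dots> = real (k + 1) * norm (S (g ^ k)) + real k * norm (S (g ^ (k + 1) * zeta))
      + norm (S ((mu - g) * ((1 - g * zeta) * P)))"
    by (simp only: norm_mult norm_of_nat)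
  also have "\<dots> \<le> real (k + 1) * (H ^ (k\<^sup>2 + 2) * sqrt Y) + real k * (3 * H ^ (k\<^sup>2 + 2) * sqrt Y)
      + 10 * real c * H ^ (k\<^sup>2 + 2) * sqrt Y"
    by (intro add_mono mult_left_mono T1 T2 T3) auto
  also have "\<dots> = real (4 * k + 1 + 10 * c) * H ^ (k\<^sup>2 + 2) * sqrt Y"
    by (simp add: algebra_simps)
  finally show ?thesis by (simp add: S_def Y_def c_def)
qed

section \<open>Removing the surplus logarithms\<close>

text \<open>Two surplus logarithms are paid for by lowering the exponent from 1/2 to
  \<open>b\<close>: by the last hypothesis \<open>H^2 * r powr b\<close> is at most
  \<open>r powr (2 * b)\<close>, and \<open>2 * b \<le> 1 / 2\<close>.\<close>

lemma absorb_logs: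
  fixes H r b :: real
  assumes "1 \<le> r" "b \<le> 1 / 4" "1 \<le> H" "H\<^sup>2 \<le> r powr b"
  shows "H ^ (m + 2) / sqrt r \<le> H ^ m / r powr b"
proof -
  have "H\<^sup>2 * r powr b \<le> r powr b * r powr b" using assms by (intro mult_right_mono) auto
  also have "\<dots> = r powr (2 * b)" by (simp add: powr_add[symmetric])
  also have "\<dots> \<le> r powr (1 / 2)" using assms by (intro powr_mono) auto
  also have "\<dots> = sqrt r" using assms by (simp add: powr_half_sqrt)
  finally have "H ^ m * (H\<^sup>2 * r powr b) \<le> H ^ m * sqrt r"
    using assms by (intro mult_left_mono) auto
  thus ?thesis using assms by (simp add: field_simps power_add power2_eq_square)
qed

text \<open>The bound \<open>ln x \<le> x powr \<delta> / \<delta>\<close> with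
  \<open>\<delta> = \<epsilon> / p\<close>, raised to the power \<open>p\<close>.\<close>

lemma ln_power_le_powr:
  fixes \<epsilon> :: real
  assumes "\<epsilon> > 0"
  shows "\<exists>C>0. \<forall>x\<ge>1. ln x ^ p \<le> C * x powr \<epsilon>"
proof (cases "p = 0")
  case True
  thus ?thesis using assms by (intro exI[of _ 1]) (auto intro: ge_one_powr_ge_zero)
next
  case False
  define \<delta> where "\<delta> = \<epsilon> / p"
  have \<delta>: "\<delta> > 0" using assms False by (simp add: \<delta>_def)
  have "ln x ^ p \<le> (1 / \<delta>) ^ p * x powr \<epsilon>" if "x \<ge> 1" for x :: real
  proof -
    have "ln x ^ p \<le> (x powr \<delta> / \<delta>) ^ p" using that \<delta> by (intro power_mono ln_powr_bound) auto
    also have "\<dots> = (1 / \<delta>) ^ p * (x powr \<delta>) ^ p" by (simp add: power_divide)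
    also have "(x powr \<delta>) ^ p = (x powr \<delta>) powr real p"
      using that by (intro powr_realpow[symmetric]) auto
    also have "\<dots> = x powr \<epsilon>" using False by (simp add: powr_powr \<delta>_def)
    finally show ?thesis .
  qed
  thus ?thesis using \<delta> by (intro exI[of _ "(1 / \<delta>) ^ p"]) auto
qed

text \<open>With \<open>r = N / q\<close>, the quantity \<open>N powr c * q powr (1 - c)\<close>
  equals \<open>N / r powr (1 - c)\<close>, so the second and third terms have the same shape in
  \<open>q\<close> and \<open>r\<close>. The hypotheses on \<open>b\<close> and \<open>c\<close>
  make both exponents at most 1/4, as \<open>absorb_logs\<close> demands; the one on
  \<open>a\<close> matches the saving \<open>sqrt V\<close>.\<close>

lemma norm_sum_moebius_conv_le:
  assumes k: "k \<ge> 2" and \<epsilon>: "\<epsilon> > 0" and a: "1 - 1 / (2 * real (k + 2)) \<le> a"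
    and b: "0 \<le> b" "b \<le> 1 / 4" and c: "3 / 4 \<le> c" "c \<le> 1"
  shows "\<exists>K>0. \<forall>\<alpha> h q N. rat_approx \<alpha> h q \<longrightarrow> N \<ge> 2 \<longrightarrow>
    norm (\<Sum>n = 1..N. of_int (moebius_conv k n) * e2pi (of_nat n * \<alpha>))
      \<le> K * (real N powr (a + \<epsilon>) + real N * ln N ^ k\<^sup>2 / real q powr b
          + real N powr c * real q powr (1 - c) * ln N ^ k\<^sup>2)"
proof -
  obtain C where C: "C > 0" "\<And>x. x \<ge> 1 \<Longrightarrow> ln x ^ (k\<^sup>2 + 2) \<le> C * x powr \<epsilon>"
    using ln_power_le_powr[OF \<epsilon>] by metis
  define A where "A = real (4 * k + 1 + 20 * (\<Sum>j<k. j + 1))"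
  define K where "K = A * (4 ^ (k\<^sup>2 + 2) * C + 4 ^ k\<^sup>2)"
  have A: "1 \<le> A" by (simp only: A_def real_of_nat_ge_one_iff)
  have K: "0 < K" using A C by (simp add: K_def add_pos_pos)
  have kk: "k + 2 \<le> k\<^sup>2"
  proof -
    have "2 * k \<le> k * k" using k by (intro mult_right_mono) auto
    thus ?thesis using k unfolding power2_eq_square by linarith
  qed
  have "norm (\<Sum>n = 1..N. of_int (moebius_conv k n) * e2pi (of_nat n * \<alpha>))
      \<le> K * (real N powr (a + \<epsilon>) + real N * ln N ^ k\<^sup>2 / real q powr b
          + real N powr c * real q powr (1 - c) * ln N ^ k\<^sup>2)"
    if approx: "rat_approx \<alpha> h q" and N2: "N \<ge> 2" for \<alpha> h q and N :: nat
  proof -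
    define S where "S = norm (\<Sum>n = 1..N. of_int (moebius_conv k n) * e2pi (of_nat n * \<alpha>))"
    define H where "H = (harm (2 * N) :: real)"
    define r where "r = real N / real q"
    define V where "V = real N powr (1 / real (k + 2))"
    define U where "U = real N * (1 / real q powr b) * H ^ k\<^sup>2"
    define W where "W = real N * (1 / r powr (1 - c)) * H ^ k\<^sup>2"
    define Z where "Z = H ^ (k\<^sup>2 + 2) * (real N / sqrt V)"
    have N: "real N \<ge> 2" "real N > 0" using N2 by auto
    have q: "q \<ge> 1" "real q \<ge> 1" using approx by (auto simp: rat_approx_def)
    have r: "r > 0" using N q by (simp add: r_def)
    have H1: "1 \<le> H" unfolding H_def using N2 by (intro one_le_harm) auto
    have V: "0 < V" unfolding V_def using N by simp
    have powH: "H ^ i \<le> H ^ j" if "i \<le> j" for i j using H1 that by (intro power_increasing)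
    have UWZ: "0 \<le> U" "0 \<le> W" "0 \<le> Z"
      using H1 V by (simp_all add: U_def W_def Z_def)
    have triv: "S \<le> real N * H ^ k"
    proof -
      have "S \<le> real N * harm N ^ k"
        unfolding S_def moebius_conv_eq by (rule norm_sum_moebius_conv_trivial)
      also have "\<dots> \<le> real N * H ^ k"
        unfolding H_def by (intro mult_left_mono power_mono harm_mono harm_nonneg) auto
      finally show ?thesis .
    qed
    \<comment> \<open>If the saving \<open>t\<close> sought is at most \<open>H^2\<close>, the
      trivial bound suffices because \<open>k + 2 \<le> k^2\<close>.\<close>
    have small: "S \<le> real N * (1 / t) * H ^ k\<^sup>2" if t: "0 < t" "t \<le> H\<^sup>2" for t
    proof -
      have "t * H ^ k \<le> H\<^sup>2 * H ^ k" using t H1 by (intro mult_right_mono) auto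
      also have "\<dots> = H ^ (k + 2)" by (simp add: power_add power2_eq_square)
      also have "\<dots> \<le> H ^ k\<^sup>2" by (rule powH[OF kk])
      finally have "H ^ k \<le> (1 / t) * H ^ k\<^sup>2" using t by (simp add: field_simps)
      hence "real N * H ^ k \<le> real N * ((1 / t) * H ^ k\<^sup>2)" by (intro mult_left_mono) auto
      thus ?thesis using triv by (simp add: mult.assoc)
    qed
    have main: "S \<le> A * (Z + U + W)"
    proof (cases "real q powr b \<le> H\<^sup>2 \<or> r powr (1 - c) \<le> H\<^sup>2")
      case True
      hence "S \<le> U \<or> S \<le> W"
        using small[of "real q powr b"] small[of "r powr (1 - c)"] q r by (auto simp: U_def W_def)
      hence "S \<le> 1 * (Z + U + W)" using UWZ by auto
      also have "\<dots> \<le> A * (Z + U + W)" using A UWZ by (intro mult_right_mono) auto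
      finally show ?thesis .
    next
      case False
      \<comment> \<open>For \<open>r < 1\<close> the power \<open>r powr (1 - c)\<close> would be at
        most 1, hence at most \<open>H^2\<close>, which the case excludes. This yields
        \<open>q \<le> N\<close>.\<close>
      have r1: "1 \<le> r"
      proof (rule ccontr)
        assume "\<not> 1 \<le> r"
        hence "r powr (1 - c) \<le> 1 powr (1 - c)" using r c by (intro powr_mono2) auto
        moreover have "1 \<le> H\<^sup>2" using H1 by simp
        ultimately show False using False by simp
      qed
      hence qN: "q \<le> N" using q by (simp add: r_def field_simps)
      have "S \<le> A * H ^ (k\<^sup>2 + 2) * sqrt (real N * (real N / real q + real N / V + real q))"
        unfolding S_def A_def H_def V_def moebius_conv_eq
        by (rule norm_sum_moebius_conv_le_sqrt[OF k approx qN])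
      also have "\<dots> \<le> A * H ^ (k\<^sup>2 + 2) * (real N / sqrt V + real N / sqrt q + real N / sqrt r)"
      proof (intro mult_left_mono real_le_lsqrt)
        \<comment> \<open>Here \<open>N * q\<close> is the square of \<open>N / sqrt r\<close>; the
          root of a sum of squares is then at most the sum of the roots.\<close>
        have "real N * (real N / real q + real N / V + real q)
            = (real N / sqrt V)\<^sup>2 + (real N / sqrt q)\<^sup>2 + (real N / sqrt r)\<^sup>2"
          using V q r N by (simp add: power_divide r_def) (simp add: field_simps power2_eq_square)
        also have "\<dots> \<le> (real N / sqrt V + real N / sqrt q + real N / sqrt r)\<^sup>2"
        proof -
          have "x\<^sup>2 + y\<^sup>2 + z\<^sup>2 \<le> (x + y + z)\<^sup>2" if "0 \<le> x" "0 \<le> y" "0 \<le> z" for x y z :: real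
            using that by (simp add: power2_eq_square algebra_simps)
          thus ?thesis using V q r by simp
        qed
        finally show "real N * (real N / real q + real N / V + real q)
            \<le> (real N / sqrt V + real N / sqrt q + real N / sqrt r)\<^sup>2" .
      qed (use A H1 V q r in auto)
      also have "\<dots> = A * (Z + real N * (H ^ (k\<^sup>2 + 2) / sqrt q) + real N * (H ^ (k\<^sup>2 + 2) / sqrt r))"
        by (simp add: Z_def algebra_simps)
      also have "\<dots> \<le> A * (Z + real N * (H ^ k\<^sup>2 / real q powr b) + real N * (H ^ k\<^sup>2 / r powr (1 - c)))"
        using A q r1 b c H1 False
        by (intro mult_left_mono add_mono absorb_logs) auto
      finally show ?thesis by (simp add: U_def W_def)
    qed
    \<comment> \<open>For \<open>N \<ge> 2\<close>, the inequalities \<open>1 \<le> 2 * ln N\<close>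
      and \<open>ln 2 \<le> ln N\<close> turn \<open>1 + ln (2 * N)\<close> into at most
      \<open>4 * ln N\<close>, whence the powers of 4 in \<open>K\<close>.\<close>
    have "2 / 3 \<le> ln (real N)" using ln2_ge_two_thirds N by (intro order_trans[OF ln2_ge_two_thirds]) simp
    hence l: "1 \<le> 2 * ln (real N)" by linarith
    have "H \<le> 1 + ln (real (2 * N))" unfolding H_def using N2 by (intro harm_le_ln) auto
    also have "\<dots> = 1 + ln 2 + ln (real N)" using N by (simp add: ln_mult)
    also have "\<dots> \<le> 4 * ln (real N)" using l ln2_le_25_over_36 ln_le_cancel_iff[of 2 "real N"] N by linarith
    finally have Hl: "H \<le> 4 * ln (real N)" .
    have Hp: "H ^ p \<le> 4 ^ p * ln N ^ p" for p
      using power_mono[OF Hl, of p] H1 by (simp add: power_mult_distrib)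
    have "Z \<le> (4 ^ (k\<^sup>2 + 2) * C) * real N powr (a + \<epsilon>)"
    proof -
      have "real N / sqrt V = real N powr (1 - 1 / (2 * real (k + 2)))"
        using N by (simp add: V_def powr_diff powr_powr mult.commute flip: powr_half_sqrt)
      also have "\<dots> \<le> real N powr a" using N a by (intro powr_mono) auto
      finally have 1: "real N / sqrt V \<le> real N powr a" .
      have "H ^ (k\<^sup>2 + 2) \<le> 4 ^ (k\<^sup>2 + 2) * (C * real N powr \<epsilon>)"
        using N by (intro order_trans[OF Hp] mult_left_mono C) auto
      hence "Z \<le> (4 ^ (k\<^sup>2 + 2) * (C * real N powr \<epsilon>)) * real N powr a"
        unfolding Z_def using 1 C V by (intro mult_mono) auto
      thus ?thesis by (simp add: powr_add mult_ac)
    qed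
    moreover have "U \<le> 4 ^ k\<^sup>2 * (real N * ln N ^ k\<^sup>2 / real q powr b)"
      using mult_left_mono[OF Hp[of "k\<^sup>2"], of "real N * (1 / real q powr b)"] by (simp add: U_def mult_ac)
    moreover have "W \<le> 4 ^ k\<^sup>2 * (real N powr c * real q powr (1 - c) * ln N ^ k\<^sup>2)"
    proof -
      have "r powr (1 - c) = real N powr (1 - c) / real q powr (1 - c)"
        unfolding r_def using N q by (simp add: powr_divide)
      moreover have "real N = real N powr c * real N powr (1 - c)"
        unfolding powr_add[symmetric] by simp
      moreover have "x * (1 / s) = y * v" if "s = u / v" "x = y * u" "u > 0" for s u v x y :: real
        using that by simp
      ultimately have "real N * (1 / r powr (1 - c)) = real N powr c * real q powr (1 - c)"
        using N by (metis powr_gt_zero less_numeral_extra(3))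
      thus ?thesis
        using mult_left_mono[OF Hp[of "k\<^sup>2"], of "real N powr c * real q powr (1 - c)"]
        by (simp add: W_def mult_ac)
    qed
    ultimately have "Z + U + W \<le> (4 ^ (k\<^sup>2 + 2) * C) * real N powr (a + \<epsilon>)
        + 4 ^ k\<^sup>2 * (real N * ln N ^ k\<^sup>2 / real q powr b)
        + 4 ^ k\<^sup>2 * (real N powr c * real q powr (1 - c) * ln N ^ k\<^sup>2)" by linarith
    also have "\<dots> \<le> (4 ^ (k\<^sup>2 + 2) * C + 4 ^ k\<^sup>2) * real N powr (a + \<epsilon>)
        + (4 ^ (k\<^sup>2 + 2) * C + 4 ^ k\<^sup>2) * (real N * ln N ^ k\<^sup>2 / real q powr b)
        + (4 ^ (k\<^sup>2 + 2) * C + 4 ^ k\<^sup>2) * (real N powr c * real q powr (1 - c) * ln N ^ k\<^sup>2)"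
      using C l by (intro add_mono mult_right_mono) auto
    also have "\<dots> = (4 ^ (k\<^sup>2 + 2) * C + 4 ^ k\<^sup>2) *
        (real N powr (a + \<epsilon>) + real N * ln N ^ k\<^sup>2 / real q powr b
          + real N powr c * real q powr (1 - c) * ln N ^ k\<^sup>2)"
      by (simp only: distrib_left)
    finally have "A * (Z + U + W) \<le> A * ((4 ^ (k\<^sup>2 + 2) * C + 4 ^ k\<^sup>2) *
        (real N powr (a + \<epsilon>) + real N * ln N ^ k\<^sup>2 / real q powr b
          + real N powr c * real q powr (1 - c) * ln N ^ k\<^sup>2))"
      using A by (intro mult_left_mono) auto
    thus ?thesis using main unfolding S_def K_def mult.assoc[of A] by linarith
  qed
  thus ?thesis using K by blast
qed

section \<open>The recursively defined exponents\<close>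

text \<open>In terms of \<open>u = 1 - a m\<close> the recurrence, shared by the sequences
  \<open>a\<close> and \<open>c\<close>, reads \<open>u \<mapsto> u / (3 + 2 * u)\<close>, so
  \<open>u\<close> shrinks at least threefold.\<close>

lemma recurrence_one_minus:
  fixes a :: "nat \<Rightarrow> real"
  assumes rec: "\<And>m. m \<ge> 1 \<Longrightarrow> a (m + 1) = (4 - a m) / (5 - 2 * a m)" and "m \<ge> 1" "a m \<le> 1"
  shows "0 \<le> 1 - a (m + 1)" "1 - a (m + 1) \<le> (1 - a m) / 3"
proof -
  define u where "u = 1 - a m"
  have u: "0 \<le> u" using assms by (simp add: u_def)
  have eq: "1 - a (m + 1) = u / (3 + 2 * u)"
    using u unfolding rec[OF assms(2)] u_def by (simp add: field_simps)
  show "0 \<le> 1 - a (m + 1)" unfolding eq using u by simp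
  show "1 - a (m + 1) \<le> (1 - a m) / 3"
    unfolding eq u_def[symmetric] using u by (intro divide_left_mono) auto
qed

text \<open>Geometric decay beats the harmonic saving obtained from \<open>V\<close>. The induction
  starts at \<open>m = 2\<close>, where \<open>1 - a 2 = 1 / 17\<close>; at \<open>m = 1\<close> the
  bound would fail, as 1/5 exceeds 1/6.\<close>

lemma one_minus_a_bounds:
  fixes a :: "nat \<Rightarrow> real"
  assumes "a 1 = 4 / 5" and rec: "\<And>m. m \<ge> 1 \<Longrightarrow> a (m + 1) = (4 - a m) / (5 - 2 * a m)" and "m \<ge> 2"
  shows "a m \<le> 1 \<and> 1 - a m \<le> 1 / (2 * real (m + 2))"
  using \<open>m \<ge> 2\<close>
proof (induction rule: dec_induct)
  case base
  have "a 2 = (4 - a 1) / (5 - 2 * a 1)" using rec[of 1] by (simp add: numeral_2_eq_2)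
  hence "a 2 = 16 / 17" unfolding assms(1) by simp
  thus ?case by simp
next
  case (step m)
  hence "(1 - a m) / 3 \<le> (1 / (2 * real (m + 2))) / 3" by (intro divide_right_mono) auto
  also have "\<dots> \<le> 1 / (2 * real (Suc m + 2))" by (simp add: field_simps)
  finally show ?case using recurrence_one_minus[of a m, OF rec] step by simp
qed

lemma b_bounds:
  fixes b :: "nat \<Rightarrow> real"
  assumes "b 1 = 1 / 2" and rec: "\<And>m. m \<ge> 1 \<Longrightarrow> b (m + 1) = b m / 3" and "m \<ge> 2"
  shows "0 \<le> b m \<and> b m \<le> 1 / 4"
  using \<open>m \<ge> 2\<close>
proof (induction rule: dec_induct)
  case base
  show ?case using rec[of 1] assms(1) by (simp add: numeral_2_eq_2)
next
  case (step m)
  thus ?case using rec[of m] by simp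
qed

lemma c_bounds:
  fixes c :: "nat \<Rightarrow> real"
  assumes "c 1 = 1 / 2" and rec: "\<And>m. m \<ge> 1 \<Longrightarrow> c (m + 1) = (4 - c m) / (5 - 2 * c m)" and "m \<ge> 2"
  shows "3 / 4 \<le> c m \<and> c m \<le> 1"
  using \<open>m \<ge> 2\<close>
proof (induction rule: dec_induct)
  case base
  have "c 2 = (4 - c 1) / (5 - 2 * c 1)" using rec[of 1] by (simp add: numeral_2_eq_2)
  hence "c 2 = 7 / 8" unfolding assms(1) by simp
  thus ?case by simp
next
  case (step m)
  thus ?case using recurrence_one_minus[of c m, OF rec] by simp
qed

theorem theorem1p5:
  fixes a b c :: "nat \<Rightarrow> real" and k :: nat and \<epsilon> :: real
  assumes "a 1 = 4 / 5" and "\<And>m. m \<ge> 1 \<Longrightarrow> a (m + 1) = (4 - a m) / (5 - 2 * a m)"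
    and "b 1 = 1 / 2" and "\<And>m. m \<ge> 1 \<Longrightarrow> b (m + 1) = b m / 3"
    and "c 1 = 1 / 2" and "\<And>m. m \<ge> 1 \<Longrightarrow> c (m + 1) = (4 - c m) / (5 - 2 * c m)"
    and "k \<ge> 2" and "\<epsilon> > 0"
  shows "\<exists>K>0. \<forall>(\<alpha>::real) (h::int) (q::nat) (X::real).
    q \<ge> 1 \<longrightarrow> coprime h (int q) \<longrightarrow>
    \<bar>\<alpha> - of_int h / of_nat q\<bar> \<le> 1 / (of_nat q)\<^sup>2 \<longrightarrow> X \<ge> 2 \<longrightarrow>
    norm (\<Sum>n = 1..nat \<lfloor>X\<rfloor>. of_int (moebius_conv k n) * e2pi (of_nat n * \<alpha>))
      \<le> K * (X powr (a k + \<epsilon>)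
             + X * ln X ^ (k\<^sup>2) / of_nat q powr b k
             + X powr c k * of_nat q powr (1 - c k) * ln X ^ (k\<^sup>2))"
proof -
  have a: "a k \<le> 1" "1 - 1 / (2 * real (k + 2)) \<le> a k"
    using one_minus_a_bounds[of a k] assms by auto
  have b: "0 \<le> b k" "b k \<le> 1 / 4" using b_bounds[of b k] assms by auto
  have c: "3 / 4 \<le> c k" "c k \<le> 1" using c_bounds[of c k] assms by auto
  \<comment> \<open>Nonnegativity of the exponent \<open>a k + \<epsilon>\<close> lets
    \<open>real N\<close> be replaced by the larger \<open>X\<close> in the first term.\<close>
  have "1 / (2 * real (k + 2)) \<le> 1" by (simp add: field_simps)
  hence a0: "0 \<le> a k + \<epsilon>" using a \<open>\<epsilon> > 0\<close> by linarith
  obtain K where K: "K > 0" "\<And>\<alpha> h q N. rat_approx \<alpha> h q \<Longrightarrow> N \<ge> 2 \<Longrightarrow>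
    norm (\<Sum>n = 1..N. of_int (moebius_conv k n) * e2pi (of_nat n * \<alpha>))
      \<le> K * (real N powr (a k + \<epsilon>) + real N * ln N ^ k\<^sup>2 / real q powr b k
          + real N powr c k * real q powr (1 - c k) * ln N ^ k\<^sup>2)"
    using norm_sum_moebius_conv_le[OF \<open>k \<ge> 2\<close> \<open>\<epsilon> > 0\<close> a(2) b c] by blast
  show ?thesis
  proof (intro exI[of _ K] conjI K(1) allI impI)
    fix \<alpha> X :: real and h :: int and q :: nat
    assume q: "q \<ge> 1" "coprime h (int q)" "\<bar>\<alpha> - of_int h / of_nat q\<bar> \<le> 1 / (of_nat q)\<^sup>2" and X: "X \<ge> 2"
    \<comment> \<open>The sum depends only on the integer part of \<open>X\<close>, and all three
      terms of the bound increase with \<open>X\<close>.\<close>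
    define N where "N = nat \<lfloor>X\<rfloor>"
    have N: "N \<ge> 2" "real N \<le> X" using X unfolding N_def by linarith+
    have approx: "rat_approx \<alpha> h q" using q by (simp add: rat_approx_def)
    have "real N powr (a k + \<epsilon>) + real N * ln N ^ k\<^sup>2 / real q powr b k
          + real N powr c k * real q powr (1 - c k) * ln N ^ k\<^sup>2
        \<le> X powr (a k + \<epsilon>) + X * ln X ^ k\<^sup>2 / real q powr b k
          + X powr c k * real q powr (1 - c k) * ln X ^ k\<^sup>2"
    proof (rule add_mono[OF add_mono])
      have ln: "ln N ^ k\<^sup>2 \<le> ln X ^ k\<^sup>2" using N X by (intro power_mono) auto
      show "real N powr (a k + \<epsilon>) \<le> X powr (a k + \<epsilon>)"
        using N a0 by (intro powr_mono2) auto
      have "real N * ln N ^ k\<^sup>2 \<le> X * ln X ^ k\<^sup>2"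
        using N X by (intro mult_mono[OF _ ln]) auto
      thus "real N * ln N ^ k\<^sup>2 / real q powr b k \<le> X * ln X ^ k\<^sup>2 / real q powr b k"
        by (rule divide_right_mono) simp
      have "real N powr c k * real q powr (1 - c k) \<le> X powr c k * real q powr (1 - c k)"
        using N c by (intro mult_right_mono powr_mono2) auto
      thus "real N powr c k * real q powr (1 - c k) * ln N ^ k\<^sup>2
          \<le> X powr c k * real q powr (1 - c k) * ln X ^ k\<^sup>2"
        using N by (intro mult_mono[OF _ ln]) auto
    qed
    hence "K * (real N powr (a k + \<epsilon>) + real N * ln N ^ k\<^sup>2 / real q powr b k
          + real N powr c k * real q powr (1 - c k) * ln N ^ k\<^sup>2)
        \<le> K * (X powr (a k + \<epsilon>) + X * ln X ^ k\<^sup>2 / real q powr b k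
          + X powr c k * real q powr (1 - c k) * ln X ^ k\<^sup>2)"
      using K(1) by (intro mult_left_mono) auto
    thus "norm (\<Sum>n = 1..nat \<lfloor>X\<rfloor>. of_int (moebius_conv k n) * e2pi (of_nat n * \<alpha>))
      \<le> K * (X powr (a k + \<epsilon>)
             + X * ln X ^ (k\<^sup>2) / of_nat q powr b k
             + X powr c k * of_nat q powr (1 - c k) * ln X ^ (k\<^sup>2))"
      using K(2)[OF approx N(1)] unfolding N_def by linarith
  qed
qed

end
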